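(* Let $b,c$ be positive integers. Then: 1. The pair $(b,1)$ is $\infty$-admissible if and only if $b=4^l-1$ for some positive integer $l$. 2. If $b\ne 1$ and $c\ne 1$, the pair $(b,c)$ is $\infty$-admissible if and only if $\frac{b+c}{\gcd(b,c)}=2^l$ for some $l$. 3. The pair $(b,1)$ is $1$-admissible if and only if $b=4^l-1$ for some positive integer $l$. 4. If $\gcd(b,c)\ge 2$ and $\frac{b+c}{\gcd(b,c)}=2^l$ for some $l$, then $(b,c)$ is $0$-admissible. 5. If $\gcd(b,c)=1$ and $\frac{b+c}{\gcd(b,c)}=4^l$ for some $l$, then $(b,c)$ is $1$-admissible. 6. If $\gcd(b,c)=1$ and $\frac{b+c}{\gcd(b,c)}=2^{2l-1}$ for some $l$, then $(b,c)$ is $8$-admissible.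
   Context: The Shrikhande graph is the Cayley graph on $\mathbb{Z}_4^2$ with connection set $\{01,03,10,30,11,33\}$. For nonnegative integers $m,n$, $D(m,n)$ is the Cartesian product of $m$ copies of the Shrikhande graph and $n$ copies of $K_4$ (vertex set $(\mathbb{Z}_4^2)^m\times\mathbb{Z}_4^n$; adjacent iff differing in exactly one coordinate by an adjacency of that factor); $D(0,n)=H(n,4)$ is the quaternary Hamming graph. A $k$-coloring of a graph is a surjective map from its vertex set onto a $k$-element set of colors; it is perfect with quotient matrix $S=(s_{ij})$ if every vertex of color $i$ has exactly $s_{ij}$ neighbours of color $j$. A perfect $(b,c)$-coloring is a perfect $2$-coloring with colors $1,2$ such that $s_{12}=b$ and $s_{21}=c$. For a nonnegative integer $a$, the pair $(b,c)$ is called $a$-admissible if there is $D$ such that a perfect $(b,c)$-coloring exists in $D(m,n)$ for all nonnegative $m,n$ with $2m+n\ge D$ and $n\ge a$. The pair $(b,c)$ is called $\infty$-admissible if there is $N$ such that a perfect $(b,c)$-coloring exists in $H(n,4)$ for all $n\ge N$.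
   Formalization: Items 2 and 4 exclude b = c odd, where the claim fails since a perfect (b,c)-coloring forces 4 | b+c; item 6 additionally assumes b ≠ 1 and c ≠ 1, since e.g. (7,1) contradicts item 1. *)

theory Defs
  imports Complex_Main "HOL-Library.Numeral_Type" "HOL-Library.Product_Plus"
begin

definition cayley_adj :: "'g::ab_group_add set \<Rightarrow> 'g \<Rightarrow> 'g \<Rightarrow> bool" where
  "cayley_adj C x y \<longleftrightarrow> y - x \<in> C"

text \<open>The type \<^typ>\<open>4\<close> is the ring of integers modulo 4, so \<^typ>\<open>4 \<times> 4\<close> is the group
  \<open>\<int>\<^sub>4\<^sup>2\<close> with componentwise operations.\<close>

definition shrikhande_adj :: "4 \<times> 4 \<Rightarrow> 4 \<times> 4 \<Rightarrow> bool" where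
  "shrikhande_adj = cayley_adj {(0,1), (0,3), (1,0), (3,0), (1,1), (3,3)}"

definition K4_adj :: "4 \<Rightarrow> 4 \<Rightarrow> bool" where
  "K4_adj x y \<longleftrightarrow> x \<noteq> y"

definition cart_power_adj :: "('a \<Rightarrow> 'a \<Rightarrow> bool) \<Rightarrow> 'a list \<Rightarrow> 'a list \<Rightarrow> bool" where
  "cart_power_adj R xs ys \<longleftrightarrow> length xs = length ys \<and>
     (\<exists>i<length xs. R (xs ! i) (ys ! i) \<and> (\<forall>j<length xs. j \<noteq> i \<longrightarrow> xs ! j = ys ! j))"

type_synonym doob_vertex = "(4 \<times> 4) list \<times> 4 list"

definition doob_verts :: "nat \<Rightarrow> nat \<Rightarrow> doob_vertex set" where
  "doob_verts m n = {xs. length xs = m} \<times> {zs. length zs = n}"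

text \<open>Adjacency does not depend on \<open>m\<close> and \<open>n\<close>: it already forces equal lengths.\<close>

definition doob_adj :: "doob_vertex \<Rightarrow> doob_vertex \<Rightarrow> bool" where
  "doob_adj u v \<longleftrightarrow>
     cart_power_adj shrikhande_adj (fst u) (fst v) \<and> snd u = snd v \<or>
     fst u = fst v \<and> cart_power_adj K4_adj (snd u) (snd v)"

definition perfect_coloring ::
  "'v set \<Rightarrow> ('v \<Rightarrow> 'v \<Rightarrow> bool) \<Rightarrow> 'c set \<Rightarrow> ('c \<Rightarrow> 'c \<Rightarrow> nat) \<Rightarrow> ('v \<Rightarrow> 'c) \<Rightarrow> bool" where
  "perfect_coloring V R C S f \<longleftrightarrow> f ` V = C \<and>
     (\<forall>i\<in>C. \<forall>j\<in>C. \<forall>v\<in>V. f v = i \<longrightarrow> card {w \<in> V. R v w \<and> f w = j} = S i j)"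

definition perfect_bc_coloring ::
  "'v set \<Rightarrow> ('v \<Rightarrow> 'v \<Rightarrow> bool) \<Rightarrow> nat \<Rightarrow> nat \<Rightarrow> ('v \<Rightarrow> nat) \<Rightarrow> bool" where
  "perfect_bc_coloring V R b c f \<longleftrightarrow>
     (\<exists>S. perfect_coloring V R {1, 2} S f \<and> S 1 2 = b \<and> S 2 1 = c)"

definition has_bc_coloring_doob :: "nat \<Rightarrow> nat \<Rightarrow> nat \<Rightarrow> nat \<Rightarrow> bool" where
  "has_bc_coloring_doob m n b c \<longleftrightarrow> (\<exists>f. perfect_bc_coloring (doob_verts m n) doob_adj b c f)"

definition admissible :: "nat \<Rightarrow> nat \<Rightarrow> nat \<Rightarrow> bool" where
  "admissible a b c \<longleftrightarrow>
     (\<exists>D. \<forall>m n. 2 * m + n \<ge> D \<and> n \<ge> a \<longrightarrow> has_bc_coloring_doob m n b c)"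

text \<open>The Hamming graph \<open>H(n,4)\<close> is \<open>D(0,n)\<close>.\<close>

definition infty_admissible :: "nat \<Rightarrow> nat \<Rightarrow> bool" where
  "infty_admissible b c \<longleftrightarrow> (\<exists>N. \<forall>n\<ge>N. has_bc_coloring_doob 0 n b c)"

end

(*
  A coloring extends to more coordinates by ignoring them, so a-admissibility only requires one
  coloring in some D(m,a) and one in some D(0,n). All colorings are obtained from equitable maps
  with a highly symmetric quotient: a k-fold cover of the complete graph on b' + c' vertices
  yields a (k b', k c')-coloring by splitting its colors arbitrarily. Such covers of complete
  graphs are enlarged by a factor of 4 by adding coordinates that map onto a complete 4-partite
  graph K(q,q,q,q); for q = 4 and q = 8 the latter are Cayley colorings coming from a partition
  of the complement of a subgroup, both with Shrikhande factors only and with K4 factors only,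
  and larger q = 2^j follow by concatenation. When b + c is an odd power of two and gcd b c = 1,
  a 1-fold cover does not exist; here one starts with a (5,3)-coloring of H(3,4) that has eight
  translates covering each vertex three times, and distributes c over the four parts of
  K(q,q,q,q), avoiding the sizes 1 and q - 1.

  Conversely, counting edges between the two colors in H(n,4) shows that (b + c) / gcd b c
  divides 4^n; and if c = 1, then the three other vertices of a line through a vertex of the
  first color have the same color, so 3 divides b.
*)
theory Submission
  imports Defs "HOL-Number_Theory.Cong" "HOL-Computational_Algebra.Primes"
begin

section \<open>Doob graphs as Cartesian products and equitable colorings\<close>

text \<open>A graph \<open>D(m,n)\<close> that maps equitably to \<open>K(q,q,q,q)\<close> has
  degree 3q, so 2m + n = q: the size of the parts dictates the number of coordinates. Quadrupling
  \<open>q\<close> from one base reaches only every second power of two. The other base has to be q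
  = 8, because q = 2 is impossible: 16 vertices would fall into 8 codes of minimum distance 3 in a
  graph of diameter 2. In the concatenation the outer coloring is evaluated on words over four
  letters, so it must live on a Hamming graph, and only the inner coloring depends on the kind of
  factor. Hence the colorings with \<open>K4\<close> factors are obtained first for all powers of
  two. For odd powers of two a single coloring does not carry an induction, since four colorings
  with different parameters have to be mixed on the same factor. Families of \<open>q\<close>
  colorings allow this because one number has two meanings: at a fixed vertex, the number of
  neighbours with the other color in one coloring equals the number of colorings in the family that
  give this vertex the other color.\<close>

lemma cart_power_adj_Nil [simp]: "\<not> cart_power_adj R [] ys"
  by (simp add: cart_power_adj_def)

lemma cart_power_adj_length: "cart_power_adj R xs ys \<Longrightarrow> length ys = length xs"
  by (simp add: cart_power_adj_def)

lemma cart_power_adj_Cons: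
  "cart_power_adj R (x # xs) (y # ys) \<longleftrightarrow> R x y \<and> xs = ys \<or> x = y \<and> cart_power_adj R xs ys"
proof -
  have "cart_power_adj R (x # xs) (y # ys) \<longleftrightarrow>
    length xs = length ys \<and> (R x y \<and> (\<forall>j<length xs. xs ! j = ys ! j) \<or>
      (\<exists>i<length xs. R (xs ! i) (ys ! i) \<and> x = y \<and> (\<forall>j<length xs. j \<noteq> i \<longrightarrow> xs ! j = ys ! j)))"
    by (simp add: cart_power_adj_def Ex_less_Suc2 All_less_Suc2)
  also have "\<dots> \<longleftrightarrow> R x y \<and> xs = ys \<or> x = y \<and> cart_power_adj R xs ys"
    by (auto simp: cart_power_adj_def list_eq_iff_nth_eq)
  finally show ?thesis .
qed

lemma cart_power_adj_append:
  "cart_power_adj R (xs @ ys) zs \<longleftrightarrow>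
    (\<exists>xs'. zs = xs' @ ys \<and> cart_power_adj R xs xs') \<or> (\<exists>ys'. zs = xs @ ys' \<and>
        cart_power_adj R ys ys')"
proof (induction xs arbitrary: zs)
  case Nil
  then show ?case by simp
next
  case (Cons x xs)
  show ?case
  proof (cases zs)
    case Nil
    then show ?thesis
      by (auto simp: cart_power_adj_def)
  next
    case (Cons z zs')
    have eq: "cart_power_adj R (x # xs) xs' \<longleftrightarrow>
      (\<exists>w ws. xs' = w # ws \<and> (R x w \<and> xs = ws \<or> x = w \<and> cart_power_adj R xs ws))" for xs'
      by (cases xs') (auto simp: cart_power_adj_Cons, simp add: cart_power_adj_def)
    show ?thesis
      unfolding Cons append_Cons cart_power_adj_Cons Cons.IH eq by auto
  qed
qed

lemma cart_power_adj_irrefl: "(\<And>x. \<not> R x x) \<Longrightarrow> \<not> cart_power_adj R xs xs"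
  by (auto simp: cart_power_adj_def)

lemma cart_power_adj_sym:
  "(\<And>x y. R x y \<Longrightarrow> R y x) \<Longrightarrow> cart_power_adj R xs ys \<Longrightarrow> cart_power_adj R ys xs"
  unfolding cart_power_adj_def by metis

lemma shrikhande_adj_irrefl: "\<not> shrikhande_adj x x"
  by (auto simp: shrikhande_adj_def cayley_adj_def zero_prod_def)

lemma K4_adj_sym: "K4_adj x y \<Longrightarrow> K4_adj y x"
  by (simp add: K4_adj_def)

section \<open>Neighbourhoods in products of Doob graphs\<close>

definition doob_nbrs :: "nat \<Rightarrow> nat \<Rightarrow> doob_vertex \<Rightarrow> doob_vertex set" where
  "doob_nbrs m n v = {w \<in> doob_verts m n. doob_adj v w}"

lemma finite_doob_verts [simp]: "finite (doob_verts m n)"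
  using finite_lists_length_eq[of "UNIV :: (4 \<times> 4) set" m] finite_lists_length_eq[of "UNIV :: 4
      set" n]
  by (simp add: doob_verts_def)

lemma finite_doob_nbrs [simp]: "finite (doob_nbrs m n v)"
  by (simp add: doob_nbrs_def)

lemma doob_nbrs_subset: "doob_nbrs m n v \<subseteq> doob_verts m n"
  by (auto simp: doob_nbrs_def)

definition vjoin :: "doob_vertex \<Rightarrow> doob_vertex \<Rightarrow> doob_vertex" where
  "vjoin x y = (fst x @ fst y, snd x @ snd y)"

definition vleft :: "nat \<Rightarrow> nat \<Rightarrow> doob_vertex \<Rightarrow> doob_vertex" where
  "vleft m n v = (take m (fst v), take n (snd v))"

definition vright :: "nat \<Rightarrow> nat \<Rightarrow> doob_vertex \<Rightarrow> doob_vertex" where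
  "vright m n v = (drop m (fst v), drop n (snd v))"

lemma vjoin_in: "x \<in> doob_verts m n \<Longrightarrow> y \<in> doob_verts m' n' \<Longrightarrow>
    vjoin x y \<in> doob_verts (m + m') (n + n')"
  by (auto simp: vjoin_def doob_verts_def)

lemma vleft_vjoin [simp]: "x \<in> doob_verts m n \<Longrightarrow> vleft m n (vjoin x y) = x"
  by (auto simp: vjoin_def vleft_def doob_verts_def)

lemma vright_vjoin [simp]: "x \<in> doob_verts m n \<Longrightarrow> vright m n (vjoin x y) = y"
  by (auto simp: vjoin_def vright_def doob_verts_def)

lemma doob_verts_add_cases:
  assumes "v \<in> doob_verts (m + m') (n + n')"
  obtains x y where "x \<in> doob_verts m n" "y \<in> doob_verts m' n'" "v = vjoin x y"
proof
  show "vleft m n v \<in> doob_verts m n" "vright m n v \<in> doob_verts m' n'"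
    using assms by (auto simp: doob_verts_def vleft_def vright_def)
  show "v = vjoin (vleft m n v) (vright m n v)"
    by (simp add: vjoin_def vleft_def vright_def)
qed

lemma doob_adj_irrefl: "\<not> doob_adj v v"
  using cart_power_adj_irrefl[of shrikhande_adj] cart_power_adj_irrefl[of K4_adj]
  by (auto simp: doob_adj_def K4_adj_def shrikhande_adj_irrefl)

lemma doob_adj_vjoin:
  "doob_adj (vjoin x y) w \<longleftrightarrow>
    (\<exists>x'. w = vjoin x' y \<and> doob_adj x x') \<or> (\<exists>y'. w = vjoin x y' \<and> doob_adj y y')"
  by (cases x; cases y; cases w) (auto simp: doob_adj_def vjoin_def cart_power_adj_append)

lemma doob_adj_in_verts: "doob_adj v w \<Longrightarrow> v \<in> doob_verts m n \<Longrightarrow> w \<in> doob_verts m n"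
  by (cases w) (auto simp: doob_adj_def doob_verts_def dest: cart_power_adj_length)

lemma doob_nbrs_vjoin:
  assumes "x \<in> doob_verts m n" "y \<in> doob_verts m' n'"
  shows "doob_nbrs (m + m') (n + n') (vjoin x y) =
    (\<lambda>x'. vjoin x' y) ` doob_nbrs m n x \<union> vjoin x ` doob_nbrs m' n' y"
  using assms by (auto simp: doob_nbrs_def doob_adj_vjoin image_iff vjoin_in dest:
      doob_adj_in_verts)

text \<open>An edge moves exactly one of the two blocks. The two kinds of neighbours are disjoint
  because a common one would leave the first block unchanged, while adjacency is
  irreflexive.\<close>

lemma sum_doob_nbrs_vjoin:
  fixes F :: "doob_vertex \<Rightarrow> nat"
  assumes x: "x \<in> doob_verts m n" and y: "y \<in> doob_verts m' n'"
  shows "(\<Sum>w\<in>doob_nbrs (m + m') (n + n') (vjoin x y). F w) =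
    (\<Sum>x'\<in>doob_nbrs m n x. F (vjoin x' y)) + (\<Sum>y'\<in>doob_nbrs m' n' y. F (vjoin x y'))"
proof -
  have inj: "inj_on (\<lambda>x'. vjoin x' y) (doob_nbrs m n x)" "inj_on (vjoin x) (doob_nbrs m' n' y)"
    by (auto simp: inj_on_def vjoin_def prod_eq_iff)
  have "(\<lambda>x'. vjoin x' y) ` doob_nbrs m n x \<inter> vjoin x ` doob_nbrs m' n' y = {}"
  proof -
    have "vjoin x' y \<noteq> vjoin x y'" if "x' \<in> doob_nbrs m n x" for x' y'
    proof
      assume "vjoin x' y = vjoin x y'"
      then have "vleft m n (vjoin x' y) = vleft m n (vjoin x y')"
        by simp
      moreover have "x' \<in> doob_verts m n"
        using that doob_nbrs_subset by blast
      ultimately have "x' = x"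
        using x by simp
      then show False
        using that doob_adj_irrefl by (auto simp: doob_nbrs_def)
    qed
    then show ?thesis by blast
  qed
  then show ?thesis
    unfolding doob_nbrs_vjoin[OF x y] using inj
    by (subst sum.union_disjoint) (simp_all add: sum.reindex)
qed

lemma doob_nbrs_1_0: "doob_nbrs 1 0 ([a], []) = (\<lambda>b. ([b], [])) ` {b. shrikhande_adj a b}"
proof -
  have adj: "doob_adj ([a], []) ([b], []) \<longleftrightarrow> shrikhande_adj a b" for b
    by (simp add: doob_adj_def cart_power_adj_Cons)
  have len1: "{xs. length xs = 1} = range (\<lambda>b :: 4 \<times> 4. [b])"
    by (rule set_eqI) (simp only: mem_Collect_eq One_nat_def length_Suc_conv length_0_conv
        image_iff, blast)
  have "doob_verts 1 0 = range (\<lambda>b. ([b], []))"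
    unfolding doob_verts_def len1 by (simp add: image_iff set_eq_iff)
  then show ?thesis
    unfolding doob_nbrs_def by (simp add: Compr_image_eq adj)
qed

lemma doob_nbrs_0_1: "doob_nbrs 0 1 ([], [a]) = (\<lambda>b. ([], [b])) ` {b. b \<noteq> a}"
proof -
  have adj: "doob_adj ([], [a]) ([], [b]) \<longleftrightarrow> b \<noteq> a" for b
    by (auto simp: doob_adj_def cart_power_adj_Cons K4_adj_def)
  have len1: "{xs. length xs = 1} = range (\<lambda>b :: 4. [b])"
    by (rule set_eqI) (simp only: mem_Collect_eq One_nat_def length_Suc_conv length_0_conv
        image_iff, blast)
  have "doob_verts 0 1 = range (\<lambda>b. ([], [b]))"
    unfolding doob_verts_def len1 by (simp add: image_iff set_eq_iff)
  then show ?thesis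
    unfolding doob_nbrs_def by (simp add: Compr_image_eq adj)
qed

lemma doob_nbrs_0_0 [simp]: "doob_nbrs 0 0 v = {}"
proof -
  have "\<not> doob_adj ([], []) w" for w
    by (auto simp: doob_adj_def)
  then show ?thesis
    by (auto simp: doob_nbrs_def doob_verts_def doob_adj_def cart_power_adj_def)
qed

text \<open>Testing against arbitrary weights \<open>\<phi>\<close> instead of counting neighbours of each color makes
  products and quotients of colorings plain manipulations of sums.\<close>

definition equitable ::
  "nat \<Rightarrow> nat \<Rightarrow> 'c set \<Rightarrow> ('c \<Rightarrow> 'c \<Rightarrow> nat) \<Rightarrow> (doob_vertex \<Rightarrow> 'c) \<Rightarrow> bool" where
  "equitable m n C M f \<longleftrightarrow> finite C \<and> f ` doob_verts m n \<subseteq> C \<and>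
     (\<forall>v\<in>doob_verts m n. \<forall>\<phi> :: 'c \<Rightarrow> nat.
        (\<Sum>w\<in>doob_nbrs m n v. \<phi> (f w)) = (\<Sum>c\<in>C. M (f v) c * \<phi> c))"

definition equit :: "nat \<Rightarrow> nat \<Rightarrow> 'c set \<Rightarrow> ('c \<Rightarrow> 'c \<Rightarrow> nat) \<Rightarrow> bool" where
  "equit m n C M \<longleftrightarrow> (\<exists>f. equitable m n C M f)"

lemma equitableI:
  assumes "finite C" "\<And>v. v \<in> doob_verts m n \<Longrightarrow> f v \<in> C"
    and "\<And>v \<phi>. v \<in> doob_verts m n \<Longrightarrow>
      (\<Sum>w\<in>doob_nbrs m n v. (\<phi> (f w) :: nat)) = (\<Sum>c\<in>C. M (f v) c * \<phi> c)"
  shows "equitable m n C M f"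
  using assms unfolding equitable_def by blast

lemma equitable_sum:
  fixes \<phi> :: "'c \<Rightarrow> nat"
  assumes "equitable m n C M f" "v \<in> doob_verts m n"
  shows "(\<Sum>w\<in>doob_nbrs m n v. \<phi> (f w)) = (\<Sum>c\<in>C. M (f v) c * \<phi> c)"
  using assms by (auto simp: equitable_def)

lemma equitable_mem: "equitable m n C M f \<Longrightarrow> v \<in> doob_verts m n \<Longrightarrow> f v \<in> C"
  by (auto simp: equitable_def)

lemma equitable_card:
  assumes "equitable m n C M f" "v \<in> doob_verts m n"
  shows "card {w \<in> doob_nbrs m n v. P (f w)} = (\<Sum>c\<in>C. M (f v) c * of_bool (P c))"
proof -
  have "card {w \<in> doob_nbrs m n v. P (f w)} = (\<Sum>w\<in>doob_nbrs m n v. of_bool (P (f w)))"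
    by (simp add: sum_of_bool_eq Collect_conj_eq)
  also have "\<dots> = (\<Sum>c\<in>C. M (f v) c * of_bool (P c))"
    by (rule equitable_sum[OF assms])
  finally show ?thesis .
qed

text \<open>The condition on \<open>M'\<close> says that \<open>r\<close> is itself equitable
  between the weighted quotients. Through this lemma later constructions can work with finite
  weighted graphs instead of vertices of Doob graphs.\<close>

lemma equit_compose:
  assumes e: "equit m n C M" and r: "r ` C \<subseteq> D" and D: "finite D"
    and M': "\<And>c d. c \<in> C \<Longrightarrow> d \<in> D \<Longrightarrow> (\<Sum>c'\<in>C. M c c' * of_bool (r c' = d)) = M' (r c) d"
  shows "equit m n D M'"
proof -
  obtain f where f: "equitable m n C M f"
    using e by (auto simp: equit_def)
  have fC: "finite C"
    using f by (simp add: equitable_def)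
  have "(\<Sum>w\<in>doob_nbrs m n v. \<phi> (r (f w))) = (\<Sum>d\<in>D. M' (r (f v)) d * \<phi> d)"
    if v: "v \<in> doob_verts m n" for v and \<phi> :: "_ \<Rightarrow> nat"
  proof -
    have fv: "f v \<in> C"
      using f v by (rule equitable_mem)
    have "(\<Sum>w\<in>doob_nbrs m n v. \<phi> (r (f w))) = (\<Sum>c\<in>C. M (f v) c * \<phi> (r c))"
      by (rule equitable_sum[OF f v])
    also have "\<dots> = (\<Sum>c\<in>C. \<Sum>d\<in>D. M (f v) c * of_bool (r c = d) * \<phi> d)"
    proof (rule sum.cong)
      fix c assume "c \<in> C"
      then have "r c \<in> D" using r by auto
      have "(\<Sum>d\<in>D. M (f v) c * of_bool (r c = d) * \<phi> d) = (\<Sum>d\<in>D. if r c =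
          d then M (f v) c * \<phi> d else 0)"
        by (rule sum.cong) auto
      then show "M (f v) c * \<phi> (r c) = (\<Sum>d\<in>D. M (f v) c * of_bool (r c = d) * \<phi> d)"
        using \<open>r c \<in> D\<close> D by simp
    qed simp
    also have "\<dots> = (\<Sum>d\<in>D. (\<Sum>c\<in>C. M (f v) c * of_bool (r c = d)) * \<phi> d)"
      by (subst sum.swap) (simp add: sum_distrib_right)
    also have "\<dots> = (\<Sum>d\<in>D. M' (r (f v)) d * \<phi> d)"
      using M' fv by simp
    finally show ?thesis .
  qed
  then have "equitable m n D M' (r \<circ> f)"
    using equitable_mem[OF f] r D by (intro equitableI) auto
  then show ?thesis
    by (auto simp: equit_def)
qed

text \<open>The Cartesian product of two weighted graphs; on the diagonal both loop weights add
  up.\<close>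

definition prodM :: "('c \<Rightarrow> 'c \<Rightarrow> nat) \<Rightarrow> ('d \<Rightarrow> 'd \<Rightarrow> nat) \<Rightarrow> 'c \<times> 'd \<Rightarrow> 'c \<times> 'd \<Rightarrow> nat" where
  "prodM M N c d = M (fst c) (fst d) * of_bool (snd d =
      snd c) + N (snd c) (snd d) * of_bool (fst d = fst c)"

lemma sum_prodM:
  assumes "finite C" "finite D" "a \<in> C" "b \<in> D"
  shows "(\<Sum>c\<in>C \<times> D. prodM M N (a, b) c * \<phi> c) =
    (\<Sum>c\<in>C. M a c * \<phi> (c, b)) + (\<Sum>d\<in>D. N b d * \<phi> (a, d))"
proof -
  have "(\<Sum>c\<in>C \<times> D. prodM M N (a, b) c * \<phi> c) =
    (\<Sum>c\<in>C. \<Sum>d\<in>D. M a c * of_bool (d = b) * \<phi> (c, d)) + (\<Sum>c\<in>C. \<Sum>d\<in>D. N b d * of_bool (c =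
        a) * \<phi> (c, d))"
    by (simp add: sum.cartesian_product' prodM_def algebra_simps sum.distrib)
  also have "(\<Sum>c\<in>C. \<Sum>d\<in>D. M a c * of_bool (d = b) * \<phi> (c, d)) = (\<Sum>c\<in>C. M a c * \<phi> (c, b))"
  proof (rule sum.cong)
    fix c
    have "(\<Sum>d\<in>D. M a c * of_bool (d = b) * \<phi> (c, d)) = (\<Sum>d\<in>D. if d = b then M a c * \<phi> (c,
        d) else 0)"
      by (rule sum.cong) auto
    then show "(\<Sum>d\<in>D. M a c * of_bool (d = b) * \<phi> (c, d)) = M a c * \<phi> (c, b)"
      using assms by simp
  qed simp
  also have "(\<Sum>c\<in>C. \<Sum>d\<in>D. N b d * of_bool (c = a) * \<phi> (c, d)) = (\<Sum>c\<in>C. if c =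
      a then \<Sum>d\<in>D. N b d * \<phi> (c, d) else 0)"
    by (rule sum.cong) auto
  finally show ?thesis
    using assms by simp
qed

lemma equit_prod:
  assumes "equit m n C M" "equit m' n' D N"
  shows "equit (m + m') (n + n') (C \<times> D) (prodM M N)"
proof -
  obtain f g where f: "equitable m n C M f" and g: "equitable m' n' D N g"
    using assms by (auto simp: equit_def)
  define h where "h = (\<lambda>v. (f (vleft m n v), g (vright m n v)))"
  have fin: "finite C" "finite D"
    using f g by (auto simp: equitable_def)
  have h: "h (vjoin x y) = (f x, g y)" if "x \<in> doob_verts m n" for x y
    using that by (simp add: h_def)
  have mem: "f x \<in> C" if "x \<in> doob_verts m n" for x
    using f that by (rule equitable_mem)
  have mem': "g x \<in> D" if "x \<in> doob_verts m' n'" for x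
    using g that by (rule equitable_mem)
  have "(\<Sum>w\<in>doob_nbrs (m + m') (n + n') v. \<phi> (h w)) = (\<Sum>c\<in>C \<times> D. prodM M N (h v) c * \<phi> c)"
    if "v \<in> doob_verts (m + m') (n + n')" for v and \<phi> :: "_ \<Rightarrow> nat"
    using that
  proof (rule doob_verts_add_cases)
    fix x y assume x: "x \<in> doob_verts m n" and y: "y \<in> doob_verts m' n'" and v: "v = vjoin x y"
    have "(\<Sum>w\<in>doob_nbrs (m + m') (n + n') v. \<phi> (h w)) =
      (\<Sum>x'\<in>doob_nbrs m n x. \<phi> (f x', g y)) + (\<Sum>y'\<in>doob_nbrs m' n' y. \<phi> (f x, g y'))"
      unfolding v sum_doob_nbrs_vjoin[OF x y] using x doob_nbrs_subset[of m n x]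
      by (intro arg_cong2[where f = "(+)"] sum.cong) (auto simp: h)
    also have "\<dots> = (\<Sum>c\<in>C. M (f x) c * \<phi> (c, g y)) + (\<Sum>d\<in>D. N (g y) d * \<phi> (f x, d))"
      using equitable_sum[OF f x, of "\<lambda>c. \<phi> (c, g y)"] equitable_sum[OF g y, of "\<lambda>d. \<phi> (f x, d)"]
      by (simp only:)
    also have "\<dots> = (\<Sum>c\<in>C \<times> D. prodM M N (f x, g y) c * \<phi> c)"
      using fin mem[OF x] mem'[OF y] by (simp add: sum_prodM)
    finally show ?thesis
      using x by (simp add: v h)
  qed
  moreover have "h v \<in> C \<times> D" if "v \<in> doob_verts (m + m') (n + n')" for v
    using that by (rule doob_verts_add_cases) (simp add: h mem mem')
  ultimately have "equitable (m + m') (n + n') (C \<times> D) (prodM M N) h"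
    using fin by (intro equitableI) auto
  then show ?thesis
    by (auto simp: equit_def)
qed

lemma equit_1_0:
  fixes \<phi> :: "4 \<times> 4 \<Rightarrow> 'c"
  assumes "finite C" "range \<phi> \<subseteq> C"
    and "\<And>a c. c \<in> C \<Longrightarrow> card {b. shrikhande_adj a b \<and> \<phi> b = c} = M (\<phi> a) c"
  shows "equit 1 0 C M"
proof -
  \<comment> \<open>The identity map is equitable for the adjacency matrix itself; every coloring of
    the factor is a quotient of it.\<close>
  have id: "equit 1 0 (UNIV :: (4 \<times> 4) set) (\<lambda>a b. of_bool (shrikhande_adj a b))"
    unfolding equit_def
  proof
    show "equitable 1 0 (UNIV :: (4 \<times> 4) set) (\<lambda>a b. of_bool (shrikhande_adj a b)) (\<lambda>v. hd (fst v))"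
      unfolding equitable_def
    proof (intro conjI ballI allI)
      fix v :: doob_vertex and \<psi> :: "4 \<times> 4 \<Rightarrow> nat"
      assume "v \<in> doob_verts 1 0"
      then obtain a where v: "v = ([a], [])"
        by (auto simp: doob_verts_def length_Suc_conv)
      have inj: "inj_on (\<lambda>b. ([b], [])) A" for A :: "(4 \<times> 4) set"
        by (auto simp: inj_on_def)
      show "(\<Sum>w\<in>doob_nbrs 1 0 v. \<psi> (hd (fst w))) =
        (\<Sum>c\<in>UNIV. of_bool (shrikhande_adj (hd (fst v)) c) * \<psi> c)"
        unfolding v doob_nbrs_1_0 by (simp add: sum.reindex[OF inj] sum_of_bool_mult_eq)
    qed auto
  qed
  show ?thesis
  proof (rule equit_compose[OF id])
    show "\<phi> ` UNIV \<subseteq> C" "finite C"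
      using assms by auto
    fix a d assume "d \<in> C"
    show "(\<Sum>b\<in>UNIV. of_bool (shrikhande_adj a b) * of_bool (\<phi> b = d)) = M (\<phi> a) d"
      unfolding assms(3)[OF \<open>d \<in> C\<close>, symmetric]
      by (simp add: of_bool_conj[symmetric] sum_of_bool_eq del: sum_of_bool_mult_eq)
  qed
qed

lemma equit_0_1:
  fixes \<phi> :: "4 \<Rightarrow> 'c"
  assumes "finite C" "range \<phi> \<subseteq> C"
    and "\<And>a c. c \<in> C \<Longrightarrow> card {b. b \<noteq> a \<and> \<phi> b = c} = M (\<phi> a) c"
  shows "equit 0 1 C M"
proof -
  have id: "equit 0 1 (UNIV :: 4 set) (\<lambda>a b. of_bool (b \<noteq> a))"
    unfolding equit_def
  proof
    show "equitable 0 1 (UNIV :: 4 set) (\<lambda>a b. of_bool (b \<noteq> a)) (\<lambda>v. hd (snd v))"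
      unfolding equitable_def
    proof (intro conjI ballI allI)
      fix v :: doob_vertex and \<psi> :: "4 \<Rightarrow> nat"
      assume "v \<in> doob_verts 0 1"
      then obtain a where v: "v = ([], [a])"
        by (auto simp: doob_verts_def length_Suc_conv)
      have inj: "inj_on (\<lambda>b. ([], [b])) A" for A :: "4 set"
        by (auto simp: inj_on_def)
      show "(\<Sum>w\<in>doob_nbrs 0 1 v. \<psi> (hd (snd w))) = (\<Sum>c\<in>UNIV. of_bool (c \<noteq> hd (snd v)) * \<psi> c)"
        unfolding v doob_nbrs_0_1 by (simp add: sum.reindex[OF inj] sum_of_bool_mult_eq)
    qed auto
  qed
  show ?thesis
  proof (rule equit_compose[OF id])
    show "\<phi> ` UNIV \<subseteq> C" "finite C"
      using assms by auto
    fix a d assume "d \<in> C"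
    show "(\<Sum>b\<in>UNIV. of_bool (b \<noteq> a) * of_bool (\<phi> b = d)) = M (\<phi> a) d"
      unfolding assms(3)[OF \<open>d \<in> C\<close>, symmetric]
      by (simp add: of_bool_conj[symmetric] sum_of_bool_eq del: sum_of_bool_mult_eq)
  qed
qed

section \<open>Multiple covers of complete graphs\<close>

lemma cayley_nbrs: "{b. cayley_adj S a b} = (\<lambda>d. d + a) ` S"
proof -
  have "b \<in> (\<lambda>d. d + a) ` S" if "b - a \<in> S" for b
    using that by (intro image_eqI[of _ _ "b - a"]) auto
  then show ?thesis
    by (auto simp: cayley_adj_def)
qed

lemma equit_0_0:
  assumes "finite C" "c \<in> C" "\<And>d. d \<in> C \<Longrightarrow> M c d = 0"
  shows "equit 0 0 C M"
proof -
  have "equitable 0 0 C M (\<lambda>_. c)"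
    using assms by (intro equitableI) auto
  then show ?thesis
    by (auto simp: equit_def)
qed

lemma equit_unit_add:
  assumes "equit m n {()} (\<lambda>_ _. d)" "equit m' n' {()} (\<lambda>_ _. d')"
  shows "equit (m + m') (n + n') {()} (\<lambda>_ _. d + d')"
  by (rule equit_compose[OF equit_prod[OF assms], of "\<lambda>_. ()"]) (auto simp: prodM_def)

text \<open>Regularity of Doob graphs, phrased as a coloring with one color so that it can enter
  products.\<close>

lemma equit_unit: "\<exists>d. equit m n {()} (\<lambda>_ _. d)"
proof -
  have m: "\<exists>d. equit m 0 {()} (\<lambda>_ _. d)"
  proof (induction m)
    case 0
    show ?case
      by (rule exI[of _ 0]) (rule equit_0_0, auto)
  next
    case (Suc m)
    have "card {b. shrikhande_adj a b} = card {b. shrikhande_adj 0 b}" for a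
      unfolding shrikhande_adj_def cayley_nbrs by (simp only: card_image inj_on_add')
    then have "equit 1 0 {()} (\<lambda>_ _. card {b. shrikhande_adj 0 b})"
      by (intro equit_1_0[of _ "\<lambda>_. ()"]) auto
    moreover obtain d where "equit m 0 {()} (\<lambda>_ _. d)"
      using Suc.IH ..
    ultimately show ?case
      using equit_unit_add[of 1 0 _ m 0 d] by auto
  qed
  have n: "\<exists>d. equit 0 n {()} (\<lambda>_ _. d)"
  proof (induction n)
    case 0
    show ?case
      by (rule exI[of _ 0]) (rule equit_0_0, auto)
  next
    case (Suc n)
    have "card {b::4. b \<noteq> a} = 3" for a
      using card_Diff_singleton[of a "UNIV :: 4 set"] by (simp add: set_diff_eq)
    then have "equit 0 1 {()} (\<lambda>_ _. 3)"
      by (intro equit_0_1[of _ "\<lambda>_. ()"]) auto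
    moreover obtain d where "equit 0 n {()} (\<lambda>_ _. d)"
      using Suc.IH ..
    ultimately show ?case
      using equit_unit_add[of 0 1 _ 0 n d] by auto
  qed
  show ?thesis
    using m n equit_unit_add[of m 0 _ 0 n] by fastforce
qed

lemma doob_degree: "\<exists>d. \<forall>v\<in>doob_verts m n. card (doob_nbrs m n v) = d"
proof -
  obtain d f where f: "equitable m n {()} (\<lambda>_ _. d) f"
    using equit_unit unfolding equit_def by blast
  show ?thesis
    using equitable_card[OF f, of _ "\<lambda>_. True"] by auto
qed

text \<open>Moves along ignored coordinates keep the color, so only the diagonal grows, by the
  degree \<open>d\<close> of the added part.\<close>

lemma equit_extend:
  assumes "equit m n C M" "m \<le> m'" "n \<le> n'"
  shows "\<exists>d. equit m' n' C (\<lambda>a b. M a b + (if b = a then d else 0))"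
proof -
  obtain d where d: "equit (m' - m) (n' - n) {()} (\<lambda>_ _. d)"
    using equit_unit by blast
  have fin: "finite C"
    using assms(1) by (auto simp: equit_def equitable_def)
  have "equit (m + (m' - m)) (n + (n' - n)) C (\<lambda>a b. M a b + (if b = a then d else 0))"
  proof (rule equit_compose[OF equit_prod[OF assms(1) d], of fst])
    fix c :: "'a \<times> unit" and e assume c: "c \<in> C \<times> {()}" and e: "e \<in> C"
    obtain a where a: "c = (a, ())" "a \<in> C"
      using c by auto
    have 1: "(\<Sum>x\<in>C. M a x * of_bool (fst (x, ()) = e)) = M a e"
    proof -
      have "(\<Sum>x\<in>C. M a x * of_bool (fst (x, ()) = e)) = (\<Sum>x\<in>C. if x = e then M a x else 0)"
        by (rule sum.cong) auto
      then show ?thesis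
        using e fin by simp
    qed
    have 2: "(\<Sum>u\<in>{()}. d * of_bool (fst (a, u) = e)) = (if e = a then d else 0)"
      by simp
    show "(\<Sum>c'\<in>C \<times> {()}. prodM M (\<lambda>_ _. d) c c' * of_bool (fst c' = e)) =
      M (fst c) e + (if e = fst c then d else 0)"
      unfolding a using fin a(2) by (subst sum_prodM) (simp_all only: 1 2, auto)
  qed (use fin in auto)
  then show ?thesis
    using assms(2,3) by auto
qed

text \<open>An equitable map to the complete graph on \<open>q\<close> vertices with edges of
  multiplicity \<open>k\<close>. The loop weight \<open>l\<close> stays free: it changes with
  ignored coordinates and does not enter counts between different colors.\<close>

definition kfold :: "nat \<Rightarrow> nat \<Rightarrow> nat \<Rightarrow> nat \<Rightarrow> bool" where
  "kfold k q m n \<longleftrightarrow> (\<exists>l. equit m n {..<q} (\<lambda>a b. if a = b then l else k))"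

text \<open>The color classes are codes of minimum distance 3.\<close>

definition multipartite :: "nat \<Rightarrow> nat \<Rightarrow> nat \<Rightarrow> bool" where
  "multipartite q m n \<longleftrightarrow> equit m n ({..<q} \<times> (UNIV :: 4 set)) (\<lambda>a b. of_bool (snd a \<noteq> snd b))"

lemma kfold_extend: "kfold k q m n \<Longrightarrow> m \<le> m' \<Longrightarrow> n \<le> n' \<Longrightarrow> kfold k q m' n'"
proof -
  assume "kfold k q m n" and le: "m \<le> m'" "n \<le> n'"
  then obtain l where l: "equit m n {..<q} (\<lambda>a b. if a = b then l else k)"
    by (auto simp: kfold_def)
  obtain d where d: "equit m' n' {..<q} (\<lambda>a b. (if a = b then l else k) + (if b = a then d else 0))"
    using equit_extend[OF l le] by blast
  have "(\<lambda>a b. (if a = b then l else k) + (if b = a then d else 0)) = (\<lambda>a b :: nat. if a =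
      b then l + d else k)"
    by (auto simp: fun_eq_iff)
  then show ?thesis
    using d by (auto simp: kfold_def)
qed

section \<open>Shifts of residues and sums of covers\<close>

lemma mod_add_bij:
  fixes q :: nat assumes "0 < q"
  shows "bij_betw (\<lambda>x. (x + b) mod q) {..<q} {..<q}"
proof -
  have "inj_on (\<lambda>x. (x + b) mod q) {..<q}"
  proof (rule inj_onI)
    fix x y assume xy: "x \<in> {..<q}" "y \<in> {..<q}" and "(x + b) mod q = (y + b) mod q"
    then have "x mod q = y mod q"
      using cong_add_rcancel_nat[of x b y q] by (simp add: cong_def)
    then show "x = y"
      using xy by simp
  qed
  moreover have "(\<lambda>x. (x + b) mod q) ` {..<q} \<subseteq> {..<q}"
    using assms by auto
  ultimately show ?thesis
    by (metis bij_betw_def endo_inj_surj finite_lessThan)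
qed

text \<open>The difference d - b modulo \<open>q\<close>, characterized by uniqueness because
  subtraction on \<open>nat\<close> is truncated.\<close>

definition mod_sub :: "nat \<Rightarrow> nat \<Rightarrow> nat \<Rightarrow> nat" where
  "mod_sub q d b = (THE x. x < q \<and> (x + b) mod q = d)"

lemma mod_sub:
  assumes "d < q"
  shows "mod_sub q d b < q" "y < q \<Longrightarrow> (y + b) mod q = d \<longleftrightarrow> y = mod_sub q d b"
proof -
  have q: "0 < q" using assms by simp
  note bij = mod_add_bij[OF q, of b]
  have "d \<in> (\<lambda>x. (x + b) mod q) ` {..<q}"
    using bij assms by (simp add: bij_betw_def)
  then obtain x where x: "d = (x + b) mod q" "x \<in> {..<q}"
    by (rule imageE)
  have uniq: "y = x" if "y < q \<and> (y + b) mod q = d" for y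
    using bij_betw_imp_inj_on[OF bij] that x unfolding inj_on_def lessThan_iff by blast
  have eq: "mod_sub q d b = x"
    unfolding mod_sub_def
  proof (rule the_equality)
    show "x < q \<and> (x + b) mod q = d"
      using x by (simp only: lessThan_iff simp_thms)
  qed (rule uniq)
  show "mod_sub q d b < q"
    using x(2) unfolding eq by (simp only: lessThan_iff)
  show "(y + b) mod q = d \<longleftrightarrow> y = mod_sub q d b" if "y < q"
    using uniq that x(1) unfolding eq by blast
qed

lemma sum_mod_shift:
  fixes h :: "nat \<Rightarrow> nat"
  assumes "d < q"
  shows "(\<Sum>y<q. h y * of_bool ((y + b) mod q = d)) = h (mod_sub q d b)"
proof -
  have "(\<Sum>y<q. h y * of_bool ((y + b) mod q = d)) = (\<Sum>y<q. if y = mod_sub q d b then h y else 0)"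
  proof (rule sum.cong)
    fix y assume "y \<in> {..<q}"
    then have iff: "(y + b) mod q = d \<longleftrightarrow> y = mod_sub q d b"
      using mod_sub(2)[OF assms] by simp
    show "h y * of_bool ((y + b) mod q = d) = (if y = mod_sub q d b then h y else 0)"
      unfolding iff by simp
  qed simp
  also have "\<dots> = h (mod_sub q d b)"
    using mod_sub(1)[OF assms, of b] by (subst sum.delta) simp_all
  finally show ?thesis .
qed

text \<open>A pair is colored by the sum of its two colors modulo \<open>q\<close>. With one
  component fixed this is a bijection of residues, so each factor contributes its own multiplicity
  to every other color.\<close>

lemma kfold_add:
  assumes "kfold k q m n" "kfold k' q m' n'" "0 < q"
  shows "kfold (k + k') q (m + m') (n + n')"
proof -
  obtain l l' where l: "equit m n {..<q} (\<lambda>a b. if a = b then l else k)"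
    and l': "equit m' n' {..<q} (\<lambda>a b. if a = b then l' else k')"
    using assms(1,2) by (auto simp: kfold_def)
  have "equit (m + m') (n + n') {..<q} (\<lambda>a b. if a = b then l + l' else k + k')"
  proof (rule equit_compose[OF equit_prod[OF l l'], of "\<lambda>(a, b). (a + b) mod q"])
    fix c :: "nat \<times> nat" and d assume c: "c \<in> {..<q} \<times> {..<q}" and "d \<in> {..<q}"
    then have d: "d < q" by simp
    obtain a b where ab: "c = (a, b)" "a < q" "b < q"
      using c by auto
    show "(\<Sum>c'\<in>{..<q} \<times> {..<q}. prodM (\<lambda>a b. if a = b then l else k) (\<lambda>a b. if a =
        b then l' else k') c c'
        * of_bool ((case c' of (a, b) \<Rightarrow> (a + b) mod q) = d)) =
      (if (case c of (a, b) \<Rightarrow> (a + b) mod q) = d then l + l' else k + k')"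
    proof -
      have 1: "(\<Sum>y<q. (if a = y then l else k) * of_bool ((case (y, b) of (a,
          b) \<Rightarrow> (a + b) mod q) = d)) =
        (if (a + b) mod q = d then l else k)"
        using sum_mod_shift[OF d, of "\<lambda>y. if a = y then l else k" b] mod_sub(2)[OF d ab(2), of b]
            by auto
      have 2: "(\<Sum>y<q. (if b = y then l' else k') * of_bool ((case (a, y) of (a,
          b) \<Rightarrow> (a + b) mod q) = d)) =
        (if (a + b) mod q = d then l' else k')"
        using sum_mod_shift[OF d, of "\<lambda>y. if b = y then l' else k'" a] mod_sub(2)[OF d ab(3), of a]
        by (auto simp: add.commute)
      show ?thesis
        unfolding ab using ab by (subst sum_prodM) (simp_all only: 1 2, auto)
    qed
  qed (use assms in auto)
  then show ?thesis
    by (auto simp: kfold_def)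
qed

lemma sum_mod_count:
  fixes q :: nat assumes "d < q"
  shows "(\<Sum>g<k * q. of_bool ((f + g) mod q = d)) = k"
proof -
  have block: "(\<Sum>g = i * q..<i * q + q. of_bool ((f + g) mod q = d)) = (1 :: nat)" for i
  proof -
    have "(\<Sum>g = i * q..<i * q + q. of_bool ((f + g) mod q = d)) =
        (\<Sum>y = 0..<q. (1 :: nat) * of_bool ((y + (f + i * q)) mod q = d))"
      using sum.shift_bounds_nat_ivl[of "\<lambda>g. of_bool ((f + g) mod q = d) :: nat" 0 "i * q" q]
      by (simp only: add.assoc add.commute add.left_commute add_0_left add_0_right mult_1)
    then show ?thesis
      by (simp only: atLeast0LessThan sum_mod_shift[OF assms])
  qed
  have "(\<Sum>g<k * q. of_bool ((f + g) mod q = d)) = (\<Sum>i<k. \<Sum>g =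
      i * q..<i * q + q. of_bool ((f + g) mod q = d) :: nat)"
    by (rule sum.nat_group[symmetric])
  then show ?thesis
    by (simp only: block) simp
qed

text \<open>An arbitrary numbering of the four parts; it serves to encode a color below
  \<open>q\<close> together with a part as one number below \<open>4 * q\<close>.\<close>

definition idx :: "4 \<Rightarrow> nat" where
  "idx = (SOME f. bij_betw f UNIV {..<4})"

lemma idx_bij: "bij_betw idx UNIV {..<4}"
proof -
  have "\<exists>f. bij_betw f (UNIV :: 4 set) {0..<CARD(4)}"
    by (rule ex_bij_betw_finite_nat) simp
  then have "\<exists>f. bij_betw f (UNIV :: 4 set) {..<4::nat}"
    by (simp only: atLeast0LessThan card_bit0 card_num1) simp
  then show ?thesis
    unfolding idx_def by (rule someI_ex)
qed

lemma idx_less: "idx x < 4"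
  using bij_betwE[OF idx_bij] by auto

lemma idx_eq_iff [simp]: "idx x = idx y \<longleftrightarrow> x = y"
  using bij_betw_imp_inj_on[OF idx_bij] by (auto simp: inj_on_def)

lemma idx_surj:
  assumes "i < 4"
  obtains x where "idx x = i"
proof -
  have "i \<in> range idx"
    using bij_betw_imp_surj_on[OF idx_bij] assms by simp
  then show thesis
    using that by (rule imageE) simp
qed

text \<open>The new color consists of \<open>(f + g) mod q\<close> and the part \<open>h\<close>. A
  move in the first factor keeps \<open>h\<close> and meets each other residue \<open>k\<close>
  times. A move in the second factor reaches every \<open>(g', h')\<close> with \<open>h'\<close>
  different from \<open>h\<close> exactly once, and the \<open>k * q\<close> values of
  \<open>g'\<close> hit each residue \<open>k\<close> times. This is why the parts must have size
  \<open>k * q\<close>.\<close>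

lemma kfold_step:
  assumes "kfold k q m n" "multipartite (k * q) m' n'" "0 < q"
  shows "kfold k (4 * q) (m + m') (n + n')"
proof -
  obtain l where l: "equit m n {..<q} (\<lambda>a b. if a = b then l else k)"
    using assms by (auto simp: kfold_def)
  have mu: "equit m' n' ({..<k * q} \<times> (UNIV :: 4 set)) (\<lambda>a b. of_bool (snd a \<noteq> snd b))"
    using assms by (simp add: multipartite_def)
  define r where "r = (\<lambda>(f, g, h). (f + g) mod q + q * idx h)"
  have r_eq: "r (f, g, h) = d + q * idx h' \<longleftrightarrow> (f + g) mod q = d \<and> h = h'" if "d < q" for f g h h' d
  proof
    assume *: "r (f, g, h) = d + q * idx h'"
    from arg_cong[OF *, of "\<lambda>x. x mod q"] arg_cong[OF *, of "\<lambda>x. x div q"]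
    show "(f + g) mod q = d \<and> h = h'"
      using that by (simp add: r_def)
  qed (use that in \<open>auto simp: r_def\<close>)
  have "equit (m + m') (n + n') {..<4 * q} (\<lambda>a b. if a = b then l else k)"
  proof (rule equit_compose[OF equit_prod[OF l mu], of r])
    fix c :: "nat \<times> nat \<times> 4" and e
    assume c: "c \<in> {..<q} \<times> {..<k * q} \<times> UNIV" and e: "e \<in> {..<4 * q}"
    obtain f g h where fgh: "c = (f, g, h)" "f < q" "g < k * q"
      using c by (cases c) auto
    have "e div q < 4"
      using e by (simp add: less_mult_imp_div_less)
    then obtain h' where h': "idx h' = e div q"
      by (rule idx_surj)
    define d where "d = e mod q"
    have d: "d < q" and e: "e = d + q * idx h'"
      using \<open>0 < q\<close> by (simp_all add: d_def h')
    have 1: "(\<Sum>y<q. (if f = y then l else k) * of_bool (r (y, g, h) = e)) =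
      (if h = h' then if (f + g) mod q = d then l else k else 0)"
      using sum_mod_shift[OF d, of "\<lambda>y. if f = y then l else k" g] mod_sub(2)[OF d fgh(2), of g]
      unfolding e r_eq[OF d] by auto
    have "(\<Sum>y\<in>{..<k * q} \<times> (UNIV :: 4 set). of_bool (snd (g, h) \<noteq> snd y) * (of_bool (r (f, y) =
        e) :: nat)) =
      (\<Sum>g'<k * q. \<Sum>b\<in>UNIV. if b = h' then of_bool (h \<noteq> h') * of_bool ((f + g') mod q = d) else 0)"
      unfolding e sum.cartesian_product' r_eq[OF d] by (intro sum.cong) auto
    also have "\<dots> = of_bool (h \<noteq> h') * (\<Sum>g'<k * q. of_bool ((f + g') mod q = d))"
      by (simp add: sum_distrib_left del: sum_of_bool_eq sum_mult_of_bool_eq)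
    also have "\<dots> = (if h = h' then 0 else k)"
      unfolding sum_mod_count[OF d] by simp
    finally have 2: "(\<Sum>y\<in>{..<k * q} \<times> (UNIV :: 4 set). of_bool (snd (g,
        h) \<noteq> snd y) * of_bool (r (f, y) = e)) =
      (if h = h' then 0 else k)" .
    have 3: "r c = e \<longleftrightarrow> (f + g) mod q = d \<and> h = h'"
      unfolding fgh(1) e r_eq[OF d] by simp
    have "(\<Sum>c'\<in>{..<q} \<times> {..<k * q} \<times> UNIV. prodM (\<lambda>a b. if a =
        b then l else k) (\<lambda>a b. of_bool (snd a \<noteq> snd b)) c c'
        * of_bool (r c' = e)) =
      (if h = h' then if (f + g) mod q = d then l else k else 0) + (if h = h' then 0 else k)"
      unfolding fgh(1) 1[symmetric] 2[symmetric] by (rule sum_prodM) (use fgh(2,3) in simp_all)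
    then show "(\<Sum>c'\<in>{..<q} \<times> {..<k * q} \<times> UNIV. prodM (\<lambda>a b. if a =
        b then l else k) (\<lambda>a b. of_bool (snd a \<noteq> snd b)) c c'
        * of_bool (r c' = e)) = (if r c = e then l else k)"
      unfolding 3 by simp
  next
    show "r ` ({..<q} \<times> {..<k * q} \<times> UNIV) \<subseteq> {..<4 * q}"
    proof
      fix e assume "e \<in> r ` ({..<q} \<times> {..<k * q} \<times> UNIV)"
      then obtain f g h where "e = (f + g) mod q + q * idx h"
        by (auto simp: r_def)
      moreover have "(f + g) mod q < q" "q * idx h \<le> q * 3"
        using idx_less[of h] \<open>0 < q\<close> by simp_all
      ultimately have "e < 4 * q"
        by linarith
      then show "e \<in> {..<4 * q}"
        by simp
    qed
  qed simp
  then show ?thesis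
    by (auto simp: kfold_def)
qed

lemma sum_neq_4: "(\<Sum>b\<in>(UNIV :: 4 set). of_bool (a \<noteq> b)) = (3 :: nat)"
proof -
  have "{b. a \<noteq> b} = UNIV - {a}" by auto
  then have "card {b. a \<noteq> b} = 3"
    by (simp add: card_Diff_singleton)
  then show ?thesis
    by (simp add: sum_of_bool_eq)
qed

text \<open>Forgetting the part leaves the first component, which occurs once in each of the three
  other parts. The same holds for the vertex's own first component, so the loop weight is 3 as
  well.\<close>

lemma kfold_multipartite:
  assumes "multipartite q m n"
  shows "kfold 3 q m n"
proof -
  have "equit m n {..<q} (\<lambda>a b. if a = b then 3 else 3)"
  proof (rule equit_compose[OF assms[unfolded multipartite_def], of fst])
    fix c :: "nat \<times> 4" and d assume d: "d \<in> {..<q}"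
    have "(\<Sum>c'\<in>{..<q} \<times> UNIV. of_bool (snd c \<noteq> snd c') * (of_bool (fst c' = d) :: nat)) =
      (\<Sum>x<q. (\<Sum>b\<in>UNIV. of_bool (snd c \<noteq> b)) * of_bool (x = d))"
      by (simp only: sum.cartesian_product' sum_distrib_right fst_conv snd_conv)
    also have "\<dots> = (\<Sum>x<q. if x = d then 3 else 0)"
      unfolding sum_neq_4 by (intro sum.cong) auto
    also have "\<dots> = 3"
      using d by simp
    finally show "(\<Sum>c'\<in>{..<q} \<times> UNIV. of_bool (snd c \<noteq> snd c') * of_bool (fst c' = d)) =
      (if fst c = d then 3 else 3 :: nat)"
      by simp
  qed auto
  then show ?thesis
    unfolding kfold_def by blast
qed

section \<open>Concatenation with Hamming graphs\<close>

lemma sum_latin: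
  fixes F :: "'b \<Rightarrow> nat" and q :: nat
  assumes "d < q" "finite B" "y \<in> B"
  shows "(\<Sum>x\<in>{..<q} \<times> B. F (snd x) * of_bool ((fst x + b) mod q = d \<and> snd x = y)) = F y"
proof -
  have "(\<Sum>x\<in>{..<q} \<times> B. F (snd x) * of_bool ((fst x + b) mod q = d \<and> snd x = y)) =
    (\<Sum>x<q. \<Sum>z\<in>B. if z = y then F y * of_bool ((x + b) mod q = d) else 0)"
    unfolding sum.cartesian_product' by (intro sum.cong) auto
  also have "\<dots> = (\<Sum>x<q. F y * of_bool ((x + b) mod q = d))"
    using assms(2,3) by (simp only: sum.delta if_True)
  finally show ?thesis
    by (simp only: sum_mod_shift[OF assms(1)])
qed

text \<open>The target is \<open>H(k,4)\<close> with each word blown up into four independent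
  copies, all copies of adjacent words being joined. For k = 1 it is
  \<open>K(4,4,4,4)\<close>.\<close>

definition hamming_cover :: "nat \<Rightarrow> nat \<Rightarrow> nat \<Rightarrow> bool" where
  "hamming_cover k m n \<longleftrightarrow> equit m n ({..<4::nat} \<times> {zs. length zs = k})
     (\<lambda>a b. of_bool (cart_power_adj K4_adj (snd a) (snd b)))"

lemma finite_length [simp]: "finite {zs :: 4 list. length zs = k}"
  using finite_lists_length_eq[of "UNIV :: 4 set" k] by simp

lemma hamming_cover_0: "hamming_cover 0 0 0"
  unfolding hamming_cover_def by (rule equit_0_0[of _ "(0, [])"]) auto

text \<open>The part of the new block becomes a further letter, and the copy index is the total of
  the first components modulo 4. A change in one block moves this total through all four residues,
  once each.\<close>

lemma hamming_cover_Suc: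
  assumes "multipartite 4 m n" "hamming_cover k m' n'"
  shows "hamming_cover (Suc k) (m + m') (n + n')"
  unfolding hamming_cover_def
proof (rule equit_compose[OF equit_prod[OF assms(1)[unfolded multipartite_def] assms(2)[unfolded
    hamming_cover_def]],
      of "\<lambda>((g, h), (a, zs)). ((g + a) mod 4, h # zs)"])
  let ?r = "\<lambda>((g, h), (a, zs)). ((g + a) mod 4 :: nat, h # zs)"
  let ?C = "{..<4} \<times> (UNIV :: 4 set)" and ?L = "{zs :: 4 list. length zs = k}"
  fix c :: "(nat \<times> 4) \<times> nat \<times> 4 list" and d :: "nat \<times> 4 list"
  assume c: "c \<in> ?C \<times> {..<4} \<times> ?L" and d: "d \<in> {..<4} \<times> {zs. length zs = Suc k}"
  obtain g h a zs where c: "c = ((g, h), (a, zs))" "g < 4" "a < 4" "zs \<in> ?L"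
    using c by auto
  obtain e w ws where d: "d = (e, w # ws)" "e < 4" "ws \<in> ?L"
    using d by (cases d) (auto simp: length_Suc_conv)
  have r1: "?r (x, (a, zs)) = d \<longleftrightarrow> (fst x + a) mod 4 = e \<and> snd x = w \<and> zs = ws" for x
    by (cases x) (simp add: d(1))
  have r2: "?r ((g, h), x) = d \<longleftrightarrow> (fst x + g) mod 4 = e \<and> snd x = ws \<and> h = w" for x
    by (cases x) (auto simp: d(1) add.commute)
  have "(\<Sum>x\<in>?C. of_bool (snd (g, h) \<noteq> snd x) * of_bool (?r (x, (a, zs)) = d)) =
      (\<Sum>x\<in>?C. of_bool (h \<noteq> snd x \<and> zs = ws) * of_bool ((fst x + a) mod 4 = e \<and> snd x = w) :: nat)"
    unfolding r1 by (rule sum.cong) auto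
  also have "\<dots> = of_bool (h \<noteq> w \<and> zs = ws)"
    by (rule sum_latin[OF d(2)]) simp_all
  finally have 1: "(\<Sum>x\<in>?C. of_bool (snd (g, h) \<noteq> snd x) * of_bool (?r (x, (a, zs)) = d)) =
      (of_bool (h \<noteq> w \<and> zs = ws) :: nat)" .
  have "(\<Sum>x\<in>{..<4::nat} \<times> ?L. of_bool (cart_power_adj K4_adj (snd (a,
      zs)) (snd x)) * of_bool (?r ((g, h), x) = d)) =
      (\<Sum>x\<in>{..<4::nat} \<times> ?L. of_bool (h = w \<and> cart_power_adj K4_adj zs (snd x)) *
        of_bool ((fst x + g) mod 4 = e \<and> snd x = ws) :: nat)"
    unfolding r2 by (rule sum.cong) auto
  also have "\<dots> = of_bool (h = w \<and> cart_power_adj K4_adj zs ws)"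
    by (rule sum_latin[OF d(2)]) (use d(3) in simp_all)
  finally have 2: "(\<Sum>x\<in>{..<4::nat} \<times> ?L. of_bool (cart_power_adj K4_adj (snd (a,
      zs)) (snd x)) * of_bool (?r ((g, h), x) = d)) =
      (of_bool (h = w \<and> cart_power_adj K4_adj zs ws) :: nat)" .
  have "(\<Sum>x\<in>?C \<times> {..<4::nat} \<times> ?L. prodM (\<lambda>a b. of_bool (snd a \<noteq> snd b)) (\<lambda>a b. of_bool
      (cart_power_adj K4_adj (snd a) (snd b))) c x
      * of_bool (?r x = d)) = of_bool (h \<noteq> w \<and> zs = ws) + of_bool (h = w \<and>
          cart_power_adj K4_adj zs ws)"
    unfolding c(1) 1[symmetric] 2[symmetric] by (rule sum_prodM) (use c(2,3,4) in simp_all)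
  also have "\<dots> = of_bool (cart_power_adj K4_adj (snd (?r c)) (snd d))"
    by (auto simp: c(1) d(1) cart_power_adj_Cons K4_adj_def)
  finally show "(\<Sum>x\<in>?C \<times> {..<4::nat} \<times> ?L. prodM (\<lambda>a b. of_bool (snd a \<noteq> snd b)) (\<lambda>a b. of_bool
      (cart_power_adj K4_adj (snd a) (snd b))) c x
      * of_bool (?r x = d)) = of_bool (cart_power_adj K4_adj (snd (?r c)) (snd d))" .
qed auto

lemma hamming_cover_power: "multipartite 4 m n \<Longrightarrow> hamming_cover k (k * m) (k * n)"
proof (induction k)
  case 0
  then show ?case
    using hamming_cover_0 by simp
next
  case (Suc k)
  then show ?case
    using hamming_cover_Suc[of m n k "k * m" "k * n"] by simp
qed

lemma doob_nbrs_hamming: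
  assumes "length zs = k"
  shows "doob_nbrs 0 k ([], zs) = Pair [] ` ({zs. length zs =
      k} \<inter> {zs'. cart_power_adj K4_adj zs zs'})"
proof -
  have eq: "doob_verts 0 k = Pair [] ` {zs. length zs = k}"
    by (auto simp: doob_verts_def)
  have "doob_adj ([], zs) ([], zs') \<longleftrightarrow> cart_power_adj K4_adj zs zs'" for zs'
    by (simp add: doob_adj_def)
  then show ?thesis
    unfolding doob_nbrs_def eq Compr_image_eq by auto
qed

lemma add_4_times_eq_iff: "a < 4 \<Longrightarrow> a + 4 * y = d \<longleftrightarrow> a mod 4 = d mod 4 \<and> y = d div 4" for a y d :: nat
  using mod_mult_div_eq[of d 4] by auto

text \<open>Around a word the outer coloring \<open>f\<close> takes each color of the three other
  parts exactly once, and every neighbouring word comes with all four copies. Taking the copy index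
  as a lowest base-4 digit therefore yields parts of size \<open>4 * q\<close> in which every color
  is again met once.\<close>

lemma multipartite_concat:
  assumes "multipartite q 0 k" "hamming_cover k m n" "0 < q"
  shows "multipartite (4 * q) m n"
proof -
  obtain f where f: "equitable 0 k ({..<q} \<times> (UNIV :: 4 set)) (\<lambda>a b. of_bool (snd a \<noteq> snd b)) f"
    using assms(1) unfolding multipartite_def equit_def by blast
  define r where "r = (\<lambda>x. (fst x + 4 * fst (f ([], snd x)), snd (f ([], snd x))))"
  let ?L = "{zs :: 4 list. length zs = k}"
  have vert: "([], zs) \<in> doob_verts 0 k" if "zs \<in> ?L" for zs
    using that by (simp add: doob_verts_def)
  show ?thesis
    unfolding multipartite_def
  proof (rule equit_compose[OF assms(2)[unfolded hamming_cover_def], of r])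
    show "r ` ({..<4} \<times> ?L) \<subseteq> {..<4 * q} \<times> UNIV"
    proof
      fix d assume "d \<in> r ` ({..<4} \<times> ?L)"
      then obtain a zs where d: "d = r (a, zs)" "a < 4" "zs \<in> ?L" by auto
      have "fst (f ([], zs)) < q"
        using equitable_mem[OF f vert[OF d(3)]] by auto
      with d(2) have "a + 4 * fst (f ([], zs)) < 4 * q"
        by linarith
      then show "d \<in> {..<4 * q} \<times> UNIV"
        by (simp add: d(1) r_def)
    qed
    fix c :: "nat \<times> 4 list" and d :: "nat \<times> 4"
    assume c: "c \<in> {..<4} \<times> ?L" and d: "d \<in> {..<4 * q} \<times> UNIV"
    define zs where "zs = snd c"
    define e where "e = (fst d div 4, snd d)"
    have zs: "zs \<in> ?L" and e: "e \<in> {..<q} \<times> UNIV"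
      using c d by (auto simp: zs_def e_def)
    \<comment> \<open>The idle \<open>+ 0\<close> brings the condition into the shape of
      \<open>sum_latin\<close>, with shift 0.\<close>
    have r: "r x = d \<longleftrightarrow> (fst x + 0) mod 4 = fst d mod 4 \<and> f ([], snd x) = e" if "x \<in> {..<4} \<times> ?L"
        for x :: "nat \<times> 4 list"
    proof -
      have "fst x < 4" using that by auto
      have "r x = d \<longleftrightarrow> fst x + 4 * fst (f ([], snd x)) = fst d \<and> snd (f ([], snd x)) = snd d"
        by (simp add: r_def prod_eq_iff)
      also have "\<dots> \<longleftrightarrow> (fst x + 0) mod 4 = fst d mod 4 \<and> f ([], snd x) = e"
        unfolding add_4_times_eq_iff[OF \<open>fst x < 4\<close>] e_def prod_eq_iff
            by (simp only: fst_conv snd_conv add_0_right conj_assoc)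
      finally show ?thesis .
    qed
    \<comment> \<open>The word of \<open>x\<close> is made a second summation variable
      \<open>y\<close>, so that \<open>sum_latin\<close> can then remove the copy index.\<close>
    have "(\<Sum>x\<in>{..<4::nat} \<times> ?L. of_bool (cart_power_adj K4_adj (snd c) (snd x)) * of_bool (r x =
        d)) =
      (\<Sum>x\<in>{..<4::nat} \<times> ?L. \<Sum>y\<in>?L. of_bool (cart_power_adj K4_adj zs (snd x) \<and> f ([], snd x) = e) *
         of_bool ((fst x + 0) mod 4 = fst d mod 4 \<and> snd x = y) :: nat)"
    proof (rule sum.cong)
      fix x :: "nat \<times> 4 list" assume x: "x \<in> {..<4} \<times> ?L"
      have "(\<Sum>y\<in>?L. of_bool (cart_power_adj K4_adj zs (snd x) \<and> f ([], snd x) = e) *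
         of_bool ((fst x + 0) mod 4 = fst d mod 4 \<and> snd x = y) :: nat) =
         (\<Sum>y\<in>?L. if snd x = y then of_bool (cart_power_adj K4_adj zs (snd x) \<and> f ([], snd x) = e) *
         of_bool ((fst x + 0) mod 4 = fst d mod 4) else 0)"
        by (rule sum.cong) auto
      also have "\<dots> = of_bool (cart_power_adj K4_adj zs (snd x) \<and> f ([], snd x) = e) *
         of_bool ((fst x + 0) mod 4 = fst d mod 4)"
        using x by (subst sum.delta') auto
      finally show "of_bool (cart_power_adj K4_adj (snd c) (snd x)) * of_bool (r x = d) =
        (\<Sum>y\<in>?L. of_bool (cart_power_adj K4_adj zs (snd x) \<and> f ([], snd x) = e) *
         of_bool ((fst x + 0) mod 4 = fst d mod 4 \<and> snd x = y) :: nat)"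
        unfolding r[OF x] zs_def of_bool_conj by (simp only: mult_ac)
    qed simp
    also have "\<dots> = (\<Sum>y\<in>?L. of_bool (cart_power_adj K4_adj zs y \<and> f ([], y) = e))"
      by (subst sum.swap) (intro sum.cong refl sum_latin, simp_all)
    also have "\<dots> = (\<Sum>w\<in>doob_nbrs 0 k ([], zs). of_bool (f w = e))"
    proof -
      have "(\<Sum>w\<in>doob_nbrs 0 k ([], zs). of_bool (f w = e)) =
        (\<Sum>y\<in>?L \<inter> {y. cart_power_adj K4_adj zs y}. of_bool (f ([], y) = e) :: nat)"
        using zs by (simp only: doob_nbrs_hamming mem_Collect_eq) (subst sum.reindex,
            auto simp: inj_on_def)
      also have "\<dots> = (\<Sum>y\<in>?L. of_bool (cart_power_adj K4_adj zs y) * of_bool (f ([], y) = e))"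
        by (rule sum_of_bool_mult_eq[symmetric]) simp
      finally show ?thesis
        by (simp only: of_bool_conj)
    qed
    also have "\<dots> = (\<Sum>x\<in>{..<q} \<times> UNIV. of_bool (snd (f ([], zs)) \<noteq> snd x) * of_bool (x = e))"
      by (rule equitable_sum[OF f vert[OF zs]])
    also have "\<dots> = (\<Sum>x\<in>{..<q} \<times> UNIV. if x = e then of_bool (snd (f ([], zs)) \<noteq> snd e) else 0)"
      by (rule sum.cong) auto
    also have "\<dots> = of_bool (snd (r c) \<noteq> snd d)"
      using e by (subst sum.delta) (auto simp: r_def zs_def e_def)
    finally show "(\<Sum>x\<in>{..<4::nat} \<times> ?L. of_bool (cart_power_adj K4_adj (snd c) (snd x)) * of_bool
        (r x = d)) =
      (of_bool (snd (r c) \<noteq> snd d) :: nat)" .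
  qed simp
qed

text \<open>Each of the \<open>k\<close> coordinates of the outer coloring is replaced by a block
  \<open>D(m,n)\<close>, whose part serves as the letter.\<close>

lemma multipartite_step:
  assumes "multipartite 4 m n" "multipartite q 0 k" "0 < q"
  shows "multipartite (4 * q) (k * m) (k * n)"
  using multipartite_concat[OF assms(2) hamming_cover_power[OF assms(1)] assms(3)] .

section \<open>Cayley colorings\<close>

text \<open>The target is a Cayley multigraph whose connection multiset is given by the
  list.\<close>

definition cayley_equit :: "nat \<Rightarrow> nat \<Rightarrow> 'h::{ab_group_add, finite} list \<Rightarrow> bool" where
  "cayley_equit m n xs \<longleftrightarrow> equit m n (UNIV :: 'h set) (\<lambda>x y. count_list xs (y - x))"

text \<open>The images of the two factors are added. Since the group is abelian, a connection
  element of either factor acts on the sum as the same translation.\<close>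

lemma cayley_equit_append:
  fixes xs ys :: "'h::{ab_group_add, finite} list"
  assumes "cayley_equit m n xs" "cayley_equit m' n' ys"
  shows "cayley_equit (m + m') (n + n') (xs @ ys)"
  unfolding cayley_equit_def
proof (rule equit_compose[OF equit_prod[OF assms[unfolded cayley_equit_def]], of "\<lambda>(x, y). x + y"])
  fix c :: "'h \<times> 'h" and d :: 'h
  obtain a b where c: "c = (a, b)" by (cases c)
  have 1: "(\<Sum>x\<in>UNIV. count_list xs (x - a) * of_bool ((case (x, b) of (x, y) \<Rightarrow> x + y) = d)) =
      count_list xs (d - b - a)"
  proof -
    have "(\<Sum>x\<in>UNIV. count_list xs (x - a) * of_bool ((case (x, b) of (x, y) \<Rightarrow> x + y) = d)) =
      (\<Sum>x\<in>UNIV. if x = d - b then count_list xs (x - a) else 0)"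
      by (rule sum.cong) (auto simp: eq_diff_eq)
    then show ?thesis by simp
  qed
  have 2: "(\<Sum>y\<in>UNIV. count_list ys (y - b) * of_bool ((case (a, y) of (x, y) \<Rightarrow> x + y) = d)) =
      count_list ys (d - a - b)"
  proof -
    have "(\<Sum>y\<in>UNIV. count_list ys (y - b) * of_bool ((case (a, y) of (x, y) \<Rightarrow> x + y) = d)) =
      (\<Sum>y\<in>UNIV. if y = d - a then count_list ys (y - b) else 0)"
      by (rule sum.cong) (auto simp: eq_diff_eq add.commute)
    then show ?thesis by simp
  qed
  have "(\<Sum>x\<in>UNIV \<times> UNIV. prodM (\<lambda>x y. count_list xs (y - x)) (\<lambda>x y. count_list ys (y - x)) c x *
      of_bool ((case x of (x, y) \<Rightarrow> x + y) = d)) = count_list xs (d - b - a) + count_list ys (d - a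
          - b)"
    unfolding c 1[symmetric] 2[symmetric] by (rule sum_prodM) simp_all
  then show "(\<Sum>x\<in>UNIV \<times> UNIV. prodM (\<lambda>x y. count_list xs (y - x)) (\<lambda>x y. count_list ys (y - x)) c
      x *
      of_bool ((case x of (x, y) \<Rightarrow> x + y) = d)) = count_list (xs @ ys) (d - (case c of (x,
          y) \<Rightarrow> x + y))"
    by (simp add: c diff_diff_eq add.commute)
qed simp_all

section \<open>Exhaustive evaluation over residues modulo 2 and 4\<close>

lemma UNIV_4: "(UNIV :: 4 set) = {0, 1, 2, 3}"
  by (rule card_subset_eq[symmetric]) simp_all

lemma UNIV_2: "(UNIV :: 2 set) = {0, 1}"
  by (rule card_subset_eq[symmetric]) simp_all

lemma forall_4: "(\<forall>x::4. P x) \<longleftrightarrow> P 0 \<and> P 1 \<and> P 2 \<and> P 3"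
proof -
  have "(\<forall>x::4. P x) \<longleftrightarrow> (\<forall>x\<in>{0, 1, 2, 3}. P x)"
    unfolding UNIV_4[symmetric] by simp
  then show ?thesis by simp
qed

lemma forall_2: "(\<forall>x::2. P x) \<longleftrightarrow> P 0 \<and> P 1"
proof -
  have "(\<forall>x::2. P x) \<longleftrightarrow> (\<forall>x\<in>{0, 1}. P x)"
    unfolding UNIV_2[symmetric] by simp
  then show ?thesis by simp
qed

lemma numerals_mod:
  "(4::4) = 0" "(5::4) = 1" "(6::4) = 2" "- (1::4) = 3" "- (2::4) = 2" "- (3::4) = 1"
  "(2::2) = 0" "- (1::2) = 1"
  by simp_all

lemma sum_4: "(\<Sum>x\<in>(UNIV :: 4 set). f x) = f 0 + f 1 + f 2 + f 3"
proof -
  have "(\<Sum>x\<in>{0, 1, 2, 3 :: 4}. f x) = f 0 + f 1 + f 2 + f 3"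
    by (simp add: add.assoc)
  then show ?thesis
    unfolding UNIV_4[symmetric] .
qed

definition smult4 :: "'h::ab_group_add \<Rightarrow> 4 \<Rightarrow> 'h" where
  "smult4 x u = (if u = 0 then 0 else if u = 1 then x else if u = 2 then x + x else x + x + x)"

lemma smult4_simps [simp]:
  "smult4 x 0 = 0" "smult4 x 1 = x" "smult4 x 2 = x + x" "smult4 x 3 = x + x + x"
  by (simp_all add: smult4_def)

lemma smult4_add:
  assumes "x + x + x + x = 0"
  shows "smult4 x (u + v) = smult4 x u + smult4 x v"
proof -
  have x: "x + (x + (x + x)) = 0" "x + (x + (x + (x + y))) = y" for y
    using assms by (simp_all add: add.assoc[symmetric])
  have "\<forall>u v. smult4 x (u + v) = smult4 x u + smult4 x v"
    unfolding forall_4 by (simp add: add.assoc x numerals_mod)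
  then show ?thesis by blast
qed

lemma card_cayley_hom:
  fixes f :: "'a::ab_group_add \<Rightarrow> 'b::ab_group_add"
  assumes "\<And>s a. f (s + a) = f s + f a"
  shows "card {b. cayley_adj S a b \<and> f b = c} = card {s \<in> S. f s = c - f a}"
proof -
  have "{b. cayley_adj S a b \<and> f b = c} = {b. cayley_adj S a b} \<inter> {b. f b = c}"
    by auto
  also have "\<dots> = (\<lambda>s. s + a) ` {s \<in> S. f s = c - f a}"
    unfolding cayley_nbrs by (auto simp: assms eq_diff_eq)
  finally show ?thesis
    by (simp only: card_image inj_on_add')
qed

text \<open>The hypotheses make (u, v) -> u x + v y a homomorphism from the group of the Shrikhande
  graph, and the list is the image of its connection set.\<close>

lemma cayley_equit_shrikhande:
  fixes x y :: "'h::{ab_group_add, finite}"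
  assumes x: "x + x + x + x = 0" and y: "y + y + y + y = 0"
  shows "cayley_equit 1 0 [x, - x, y, - y, x + y, - (x + y)]"
  unfolding cayley_equit_def
proof (rule equit_1_0[of _ "\<lambda>u. smult4 x (fst u) + smult4 y (snd u)"])
  let ?f = "\<lambda>u. smult4 x (fst u) + smult4 y (snd u)"
  let ?S = "{(0, 1), (0, 3), (1, 0), (3, 0), (1, 1), (3, 3)} :: (4 \<times> 4) set"
  have add: "?f (s + a) = ?f s + ?f a" for s a :: "4 \<times> 4"
    by (simp only: fst_add snd_add smult4_add[OF x] smult4_add[OF y] add_ac)
  have neg: "x + x + x = - x" "y + y + y = - y"
    using x y by (simp_all only: eq_neg_iff_add_eq_0)
  fix a :: "4 \<times> 4" and c :: 'h
  have sum_S: "(\<Sum>s\<in>?S. F s) = F (3, 0) + F (1, 0) + F (0, 3) + F (0, 1) + F (3, 3) + F (1, 1)"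
      for F :: "4 \<times> 4 \<Rightarrow> nat"
    by simp
  have count: "count_list [b, b', d, d', e, e'] z = of_bool (b' = z) + of_bool (b = z) +
      of_bool (d' = z) + of_bool (d = z) + of_bool (e' = z) + of_bool (e = z)"
          for b b' d d' e e' z :: 'h
    by simp
  have "card {b. shrikhande_adj a b \<and> ?f b = c} = card {s \<in> ?S. ?f s = c - ?f a}"
    unfolding shrikhande_adj_def by (rule card_cayley_hom) (rule add)
  also have "\<dots> = (\<Sum>s\<in>?S. of_bool (?f s = c - ?f a))"
    by (simp only: sum_of_bool_eq finite_insert finite.emptyI of_nat_id Int_def mem_Collect_eq)
  also have "\<dots> = count_list [x, - x, y, - y, x + y, - (x + y)] (c - ?f a)"
    unfolding sum_S count fst_conv snd_conv smult4_simps neg add_0_left add_0_right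
        minus_add_distrib ..
  finally show "card {b. shrikhande_adj a b \<and> ?f b = c} = count_list [x, - x, y, - y, x + y,
      - (x + y)] (c - ?f a)" .
qed simp_all

text \<open>Here \<open>K4\<close> is the Cayley graph of the Klein four-group. The residues of type
  \<open>4\<close> are mere labels for 0, x, y and x + y, not group elements, so the counts are
  compared case by case instead of by a homomorphism.\<close>

lemma cayley_equit_K4:
  fixes x y :: "'h::{ab_group_add, finite}"
  assumes x: "x + x = 0" and y: "y + y = 0"
  shows "cayley_equit 0 1 [x, y, x + y]"
  unfolding cayley_equit_def
proof (rule equit_0_1[of _ "\<lambda>b. if b = 0 then 0 else if b = 1 then x else if b =
    2 then y else x + y"])
  let ?f = "\<lambda>b::4. if b = 0 then 0 else if b = 1 then x else if b = 2 then y else x + y"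
  fix a :: 4 and c :: 'h
  have xy: "x + (x + z) = z" "y + (y + z) = z" for z
    using x y by (simp_all add: add.assoc[symmetric])
  have "{b. b \<noteq> a \<and> ?f b = c} = UNIV \<inter> {b. b \<noteq> a \<and> ?f b = c}"
    by simp
  then have "card {b. b \<noteq> a \<and> ?f b = c} = (\<Sum>b\<in>UNIV. of_bool (b \<noteq> a \<and> ?f b = c))"
    by (simp only: sum_of_bool_eq finite of_nat_id)
  also have "\<dots> = count_list [x, y, x + y] (c - ?f a)"
  proof -
    have count: "count_list [x, y, x + y] (c - z) = of_bool (x + z = c) + of_bool (y + z =
        c) + of_bool (x + y + z = c)" for z
      by (simp add: eq_diff_eq)
    have "\<forall>a. (\<Sum>b\<in>UNIV. of_bool (b \<noteq> a \<and> ?f b = c)) = count_list [x, y, x + y] (c - ?f a)"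
      unfolding forall_4 sum_4 count by (simp add: x y xy add_ac)
    then show ?thesis by blast
  qed
  finally show "card {b. b \<noteq> a \<and> ?f b = c} = count_list [x, y, x + y] (c - ?f a)" .
qed simp_all

text \<open>If the connection elements are exactly those outside the kernel of \<open>\<pi>\<close>,
  once each, then two elements are joined precisely when they lie in different cosets. The four
  cosets are the parts; \<open>\<rho>\<close> numbers the cosets and \<open>g p\<close> the elements
  of one coset.\<close>

lemma multipartite_cayley:
  fixes \<pi> :: "'h::{ab_group_add, finite} \<Rightarrow> 2 \<times> 2"
  assumes e: "cayley_equit m n xs"
    and add: "\<And>x y. \<pi> (x + y) = \<pi> x + \<pi> y"
    and xs: "\<And>x. count_list xs x = of_bool (\<pi> x \<noteq> 0)"
    and card: "\<And>p. card {x. \<pi> x = p} = q"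
  shows "multipartite q m n"
proof -
  define \<rho> where "\<rho> = (\<lambda>p :: 2 \<times> 2. if p = (0, 0) then 0 else if p = (0, 1) then 1 else if p =
      (1, 0) then 2 else 3 :: 4)"
  have rho: "\<rho> (0, 0) = 0" "\<rho> (0, 1) = 1" "\<rho> (1, 0) = 2" "\<rho> (1, 1) = 3"
    by (simp_all add: \<rho>_def)
  have "\<forall>p p'. \<rho> p = \<rho> p' \<longrightarrow> p = p'"
    unfolding split_paired_All forall_2 rho by simp
  moreover have "\<forall>d. \<exists>p. d = \<rho> p"
    unfolding forall_4 by (intro conjI) (rule exI, rule rho[symmetric])+
  ultimately have "bij \<rho>"
    unfolding bij_def inj_def surj_def by blast
  have "\<exists>g. bij_betw g {x. \<pi> x = p} {..<q}" for p
    using ex_bij_betw_finite_nat[of "{x. \<pi> x = p}"] by (simp add: card atLeast0LessThan)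
  then have "\<forall>p. \<exists>g. bij_betw g {x. \<pi> x = p} {..<q}" by blast
  then obtain g where g: "\<And>p. bij_betw (g p) {x. \<pi> x = p} {..<q}"
    unfolding choice_iff by (elim exE) blast
  define r where "r = (\<lambda>x. (g (\<pi> x) x, \<rho> (\<pi> x)))"
  have rho_eq: "\<rho> p = \<rho> p' \<longleftrightarrow> p = p'" for p p'
    using bij_is_inj[OF \<open>bij \<rho>\<close>] by (simp add: inj_eq)
  have ne: "\<pi> (x - y) \<noteq> 0 \<longleftrightarrow> \<pi> x \<noteq> \<pi> y" for x y
    using add[of "x - y" y] by (metis add_cancel_left_left diff_add_cancel)
  show ?thesis
    unfolding multipartite_def
  proof (rule equit_compose[OF e[unfolded cayley_equit_def], of r])
    show "r ` UNIV \<subseteq> {..<q} \<times> UNIV"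
    proof -
      have "g (\<pi> x) x \<in> {..<q}" for x
        using bij_betwE[OF g[of "\<pi> x"]] by blast
      then show ?thesis by (auto simp: r_def)
    qed
    fix x :: 'h and d :: "nat \<times> 4" assume d: "d \<in> {..<q} \<times> UNIV"
    define p where "p = inv \<rho> (snd d)"
    have p: "\<rho> p = snd d"
      using \<open>bij \<rho>\<close> by (simp add: p_def bij_is_surj surj_f_inv_f)
    have "fst d \<in> g p ` {x. \<pi> x = p}"
      using bij_betw_imp_surj_on[OF g] d by auto
    then obtain y where y: "fst d = g p y" "y \<in> {x. \<pi> x = p}"
      by (rule imageE)
    have r: "r z = d \<longleftrightarrow> z = y" for z
    proof
      assume "r z = d"
      then have z: "g (\<pi> z) z = fst d" "\<rho> (\<pi> z) = \<rho> p"
        unfolding p by (auto simp: r_def)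
      have "\<pi> z = p"
        using z(2) unfolding rho_eq .
      then show "z = y"
        using z(1) y bij_betw_imp_inj_on[OF g[of p]] by (auto simp: inj_on_def)
    next
      have "\<pi> y = p"
        using y(2) by (simp only: mem_Collect_eq)
      then have "r y = (fst d, snd d)"
        unfolding r_def by (simp only: y(1)[symmetric] p)
      then show "z = y \<Longrightarrow> r z = d"
        by simp
    qed
    have "(\<Sum>z\<in>UNIV. count_list xs (z - x) * of_bool (r z = d)) = (\<Sum>z\<in>UNIV. if z =
        y then count_list xs (z - x) else 0)"
      unfolding r by (rule sum.cong) auto
    also have "\<dots> = of_bool (\<pi> y \<noteq> \<pi> x)"
      by (simp add: xs ne)
    also have "\<dots> = of_bool (snd (r x) \<noteq> snd d)"
      using y(2) by (auto simp: r_def p[symmetric] rho_eq)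
    finally show "(\<Sum>z\<in>UNIV. count_list xs (z - x) * of_bool (r z = d)) =
        of_bool (snd (r x) \<noteq> snd d)" .
  qed simp
qed

section \<open>The base multipartite colorings\<close>

definition parity4 :: "4 \<Rightarrow> 2" where
  "parity4 u = (if u = 1 \<or> u = 3 then 1 else 0)"

lemma parity4_simps [simp]: "parity4 0 = 0" "parity4 1 = 1" "parity4 2 = 0" "parity4 3 = 1"
  by (simp_all add: parity4_def)

lemma parity4_add: "parity4 (u + v) = parity4 u + parity4 v"
proof -
  have "\<forall>u v. parity4 (u + v) = parity4 u + parity4 v"
    unfolding forall_4 by (simp add: numerals_mod)
  then show ?thesis by blast
qed

lemma card_parity4: "card {u. parity4 u = p} = 2"
proof -
  have "\<forall>p. (\<Sum>u\<in>UNIV. of_bool (parity4 u = p)) = (2 :: nat)"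
    unfolding forall_2 sum_4 by simp
  then show ?thesis
    by (simp add: sum_of_bool_eq)
qed

text \<open>The kernel of reduction modulo 2 has order 4. The sextets +-x, +-y, +-(x + y) generated
  by (1,0), (0,1) and by (1,2), (2,3) partition the remaining twelve elements.\<close>

lemma multipartite_4_shrikhande: "multipartite 4 2 0"
proof -
  have e0: "cayley_equit 1 0 ([(1, 0), (3, 0), (0, 1), (0, 3), (1, 1), (3, 3)] :: (4 \<times> 4) list)"
    using cayley_equit_shrikhande[of "(1, 0) :: 4 \<times> 4" "(0, 1)"]
        by (simp add: zero_prod_def numerals_mod)
  have e1: "cayley_equit 1 0 ([(1, 2), (3, 2), (2, 3), (2, 1), (3, 1), (1, 3)] :: (4 \<times> 4) list)"
    using cayley_equit_shrikhande[of "(1, 2) :: 4 \<times> 4" "(2, 3)"]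
        by (simp add: zero_prod_def numerals_mod)
  note e = cayley_equit_append[OF e0 e1]
  define xs where "xs = [(1, 0), (3, 0), (0, 1), (0, 3), (1, 1), (3, 3), (1, 2), (3, 2), (2, 3),
      (2, 1), (3, 1), (1, 3) :: 4 \<times> 4]"
  have "cayley_equit 2 0 xs"
    using e by (simp add: xs_def numeral_eq_Suc)
  then show ?thesis
  proof (rule multipartite_cayley)
    show "(\<lambda>x. (parity4 (fst x), parity4 (snd x))) (x + y) = (\<lambda>x. (parity4 (fst x),
        parity4 (snd x))) x + (\<lambda>x. (parity4 (fst x), parity4 (snd x))) y" for x y
      by (simp only: fst_add snd_add parity4_add add_Pair)
    have "\<forall>x. count_list xs x = of_bool ((\<lambda>x. (parity4 (fst x), parity4 (snd x))) x \<noteq> 0)"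
      unfolding split_paired_All forall_4 xs_def by (simp add: zero_prod_def)
    then show "count_list xs x = of_bool ((\<lambda>x. (parity4 (fst x), parity4 (snd x))) x \<noteq> 0)" for x
      by blast
    show "card {x. (\<lambda>x. (parity4 (fst x), parity4 (snd x))) x = p} = 4" for p
    proof -
      have "{x. (parity4 (fst x), parity4 (snd x)) = p} = {u. parity4 u = fst p} \<times> {v. parity4 v =
          snd p}"
        by (auto simp only: prod_eq_iff mem_Times_iff mem_Collect_eq fst_conv snd_conv)
      then show ?thesis
        by (simp only: card_cartesian_product card_parity4)
    qed
  qed
qed

text \<open>An additional binary coordinate doubles the kernel to order 8, and four sextets of the
  same form partition the 24 elements outside it.\<close>

lemma multipartite_8_shrikhande: "multipartite 8 4 0"
proof -
  have e0: "cayley_equit 1 0 ([(1, 0, 0), (3, 0, 0), (0, 1, 0), (0, 3, 0), (1, 1, 0),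
      (3, 3, 0)] :: (4 \<times> 4 \<times> 2) list)"
    using cayley_equit_shrikhande[of "(1, 0, 0) :: 4 \<times> 4 \<times> 2" "(0, 1, 0)"]
        by (simp add: zero_prod_def numerals_mod)
  have e1: "cayley_equit 1 0 ([(1, 0, 1), (3, 0, 1), (0, 3, 1), (0, 1, 1), (1, 3, 0),
      (3, 1, 0)] :: (4 \<times> 4 \<times> 2) list)"
    using cayley_equit_shrikhande[of "(1, 0, 1) :: 4 \<times> 4 \<times> 2" "(0, 3, 1)"]
        by (simp add: zero_prod_def numerals_mod)
  have e2: "cayley_equit 1 0 ([(1, 2, 0), (3, 2, 0), (2, 1, 1), (2, 3, 1), (3, 3, 1),
      (1, 1, 1)] :: (4 \<times> 4 \<times> 2) list)"
    using cayley_equit_shrikhande[of "(1, 2, 0) :: 4 \<times> 4 \<times> 2" "(2, 1, 1)"]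
        by (simp add: zero_prod_def numerals_mod)
  have e3: "cayley_equit 1 0 ([(1, 2, 1), (3, 2, 1), (2, 3, 0), (2, 1, 0), (3, 1, 1),
      (1, 3, 1)] :: (4 \<times> 4 \<times> 2) list)"
    using cayley_equit_shrikhande[of "(1, 2, 1) :: 4 \<times> 4 \<times> 2" "(2, 3, 0)"]
        by (simp add: zero_prod_def numerals_mod)
  note e = cayley_equit_append[OF cayley_equit_append[OF e0 e1] cayley_equit_append[OF e2 e3]]
  define xs where "xs = [(1, 0, 0), (3, 0, 0), (0, 1, 0), (0, 3, 0), (1, 1, 0), (3, 3, 0),
      (1, 0, 1), (3, 0, 1), (0, 3, 1), (0, 1, 1), (1, 3, 0), (3, 1, 0), (1, 2, 0), (3, 2, 0),
      (2, 1, 1), (2, 3, 1), (3, 3, 1), (1, 1, 1), (1, 2, 1), (3, 2, 1), (2, 3, 0), (2, 1, 0),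
      (3, 1, 1), (1, 3, 1) :: 4 \<times> 4 \<times> 2]"
  have "cayley_equit 4 0 xs"
    using e by (simp add: xs_def numeral_eq_Suc)
  then show ?thesis
  proof (rule multipartite_cayley)
    show "(\<lambda>x. (parity4 (fst x), parity4 (fst (snd x)))) (x + y) = (\<lambda>x. (parity4 (fst x),
        parity4 (fst (snd x)))) x + (\<lambda>x. (parity4 (fst x), parity4 (fst (snd x)))) y" for x y
      by (simp only: fst_add snd_add parity4_add add_Pair)
    have "\<forall>x. count_list xs x = of_bool ((\<lambda>x. (parity4 (fst x), parity4 (fst (snd x)))) x \<noteq> 0)"
      unfolding split_paired_All forall_4 forall_2 xs_def by (simp add: zero_prod_def)
    then show "count_list xs x = of_bool ((\<lambda>x. (parity4 (fst x), parity4 (fst (snd x)))) x \<noteq> 0)"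
        for x
      by blast
    show "card {x :: 4 \<times> 4 \<times> 2. (\<lambda>x. (parity4 (fst x), parity4 (fst (snd x)))) x = p} = 8" for p
    proof -
      have "{x :: 4 \<times> 4 \<times> 2. (parity4 (fst x), parity4 (fst (snd x))) = p} =
          {u. parity4 u = fst p} \<times> {v. parity4 v = snd p} \<times> UNIV"
        by (auto simp only: prod_eq_iff mem_Times_iff mem_Collect_eq fst_conv snd_conv UNIV_I)
      then show ?thesis
        by (simp only: card_cartesian_product card_parity4) simp
    qed
  qed
qed

text \<open>Over \<open>GF(4)\<close> the lines are spanned by \<open>(a, 1)\<close>, and in \<open>GF(8) \<times> GF(4)\<close> they are
  \<open>{(a \<lambda>, \<lambda>)}\<close>, where \<open>GF(4)\<close> is embedded additively in \<open>GF(8)\<close> as the span of \<open>1\<close> and \<open>t\<close>,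
  \<open>t\<^sup>3 = t + 1\<close>.\<close>

lemma multipartite_4_hamming: "multipartite 4 0 4"
proof -
  have e0: "cayley_equit 0 1 ([((0, 0), (0, 1)), ((0, 0), (1, 0)), ((0, 0),
      (1, 1))] :: ((2 \<times> 2) \<times> 2 \<times> 2) list)"
    using cayley_equit_K4[of "((0, 0), (0, 1)) :: (2 \<times> 2) \<times> 2 \<times> 2" "((0, 0), (1, 0))"]
        by (simp add: zero_prod_def numerals_mod)
  have e1: "cayley_equit 0 1 ([((0, 1), (0, 1)), ((1, 0), (1, 0)), ((1, 1),
      (1, 1))] :: ((2 \<times> 2) \<times> 2 \<times> 2) list)"
    using cayley_equit_K4[of "((0, 1), (0, 1)) :: (2 \<times> 2) \<times> 2 \<times> 2" "((1, 0), (1, 0))"]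
        by (simp add: zero_prod_def numerals_mod)
  have e2: "cayley_equit 0 1 ([((1, 0), (0, 1)), ((1, 1), (1, 0)), ((0, 1),
      (1, 1))] :: ((2 \<times> 2) \<times> 2 \<times> 2) list)"
    using cayley_equit_K4[of "((1, 0), (0, 1)) :: (2 \<times> 2) \<times> 2 \<times> 2" "((1, 1), (1, 0))"]
        by (simp add: zero_prod_def numerals_mod)
  have e3: "cayley_equit 0 1 ([((1, 1), (0, 1)), ((0, 1), (1, 0)), ((1, 0),
      (1, 1))] :: ((2 \<times> 2) \<times> 2 \<times> 2) list)"
    using cayley_equit_K4[of "((1, 1), (0, 1)) :: (2 \<times> 2) \<times> 2 \<times> 2" "((0, 1), (1, 0))"]
        by (simp add: zero_prod_def numerals_mod)
  note e = cayley_equit_append[OF cayley_equit_append[OF e0 e1] cayley_equit_append[OF e2 e3]]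
  define xs where "xs = [((0, 0), (0, 1)), ((0, 0), (1, 0)), ((0, 0), (1, 1)), ((0, 1), (0, 1)),
      ((1, 0), (1, 0)), ((1, 1), (1, 1)), ((1, 0), (0, 1)), ((1, 1), (1, 0)), ((0, 1), (1, 1)),
      ((1, 1), (0, 1)), ((0, 1), (1, 0)), ((1, 0), (1, 1)) :: (2 \<times> 2) \<times> 2 \<times> 2]"
  have "cayley_equit 0 4 xs"
    using e by (simp add: xs_def numeral_eq_Suc)
  then show ?thesis
  proof (rule multipartite_cayley)
    show "snd (x + y) = snd x + snd y" for x y
      by (rule snd_add)
    have "\<forall>x. count_list xs x = of_bool (snd x \<noteq> 0)"
      unfolding split_paired_All forall_2 xs_def by (simp add: zero_prod_def)
    then show "count_list xs x = of_bool (snd x \<noteq> 0)" for x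
      by blast
    show "card {x :: (2 \<times> 2) \<times> 2 \<times> 2. snd x = p} = 4" for p
    proof -
      have "{x :: (2 \<times> 2) \<times> 2 \<times> 2. snd x = p} = UNIV \<times> {p}"
        by auto
      then show ?thesis
        by (simp only: card_cartesian_product) simp
    qed
  qed
qed

lemma multipartite_8_hamming: "multipartite 8 0 8"
proof -
  have e0: "cayley_equit 0 1 ([((0, 0, 0), (0, 1)), ((0, 0, 0), (1, 0)), ((0, 0, 0),
      (1, 1))] :: ((2 \<times> 2 \<times> 2) \<times> 2 \<times> 2) list)"
    using cayley_equit_K4[of "((0, 0, 0), (0, 1)) :: (2 \<times> 2 \<times> 2) \<times> 2 \<times> 2" "((0, 0, 0), (1, 0))"]
        by (simp add: zero_prod_def numerals_mod)
  have e1: "cayley_equit 0 1 ([((0, 0, 1), (0, 1)), ((0, 1, 0), (1, 0)), ((0, 1, 1),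
      (1, 1))] :: ((2 \<times> 2 \<times> 2) \<times> 2 \<times> 2) list)"
    using cayley_equit_K4[of "((0, 0, 1), (0, 1)) :: (2 \<times> 2 \<times> 2) \<times> 2 \<times> 2" "((0, 1, 0), (1, 0))"]
        by (simp add: zero_prod_def numerals_mod)
  have e2: "cayley_equit 0 1 ([((0, 1, 0), (0, 1)), ((1, 0, 0), (1, 0)), ((1, 1, 0),
      (1, 1))] :: ((2 \<times> 2 \<times> 2) \<times> 2 \<times> 2) list)"
    using cayley_equit_K4[of "((0, 1, 0), (0, 1)) :: (2 \<times> 2 \<times> 2) \<times> 2 \<times> 2" "((1, 0, 0), (1, 0))"]
        by (simp add: zero_prod_def numerals_mod)
  have e3: "cayley_equit 0 1 ([((0, 1, 1), (0, 1)), ((1, 1, 0), (1, 0)), ((1, 0, 1),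
      (1, 1))] :: ((2 \<times> 2 \<times> 2) \<times> 2 \<times> 2) list)"
    using cayley_equit_K4[of "((0, 1, 1), (0, 1)) :: (2 \<times> 2 \<times> 2) \<times> 2 \<times> 2" "((1, 1, 0), (1, 0))"]
        by (simp add: zero_prod_def numerals_mod)
  have e4: "cayley_equit 0 1 ([((1, 0, 0), (0, 1)), ((0, 1, 1), (1, 0)), ((1, 1, 1),
      (1, 1))] :: ((2 \<times> 2 \<times> 2) \<times> 2 \<times> 2) list)"
    using cayley_equit_K4[of "((1, 0, 0), (0, 1)) :: (2 \<times> 2 \<times> 2) \<times> 2 \<times> 2" "((0, 1, 1), (1, 0))"]
        by (simp add: zero_prod_def numerals_mod)
  have e5: "cayley_equit 0 1 ([((1, 0, 1), (0, 1)), ((0, 0, 1), (1, 0)), ((1, 0, 0),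
      (1, 1))] :: ((2 \<times> 2 \<times> 2) \<times> 2 \<times> 2) list)"
    using cayley_equit_K4[of "((1, 0, 1), (0, 1)) :: (2 \<times> 2 \<times> 2) \<times> 2 \<times> 2" "((0, 0, 1), (1, 0))"]
        by (simp add: zero_prod_def numerals_mod)
  have e6: "cayley_equit 0 1 ([((1, 1, 0), (0, 1)), ((1, 1, 1), (1, 0)), ((0, 0, 1),
      (1, 1))] :: ((2 \<times> 2 \<times> 2) \<times> 2 \<times> 2) list)"
    using cayley_equit_K4[of "((1, 1, 0), (0, 1)) :: (2 \<times> 2 \<times> 2) \<times> 2 \<times> 2" "((1, 1, 1), (1, 0))"]
        by (simp add: zero_prod_def numerals_mod)
  have e7: "cayley_equit 0 1 ([((1, 1, 1), (0, 1)), ((1, 0, 1), (1, 0)), ((0, 1, 0),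
      (1, 1))] :: ((2 \<times> 2 \<times> 2) \<times> 2 \<times> 2) list)"
    using cayley_equit_K4[of "((1, 1, 1), (0, 1)) :: (2 \<times> 2 \<times> 2) \<times> 2 \<times> 2" "((1, 0, 1), (1, 0))"]
        by (simp add: zero_prod_def numerals_mod)
  note e = cayley_equit_append[OF cayley_equit_append[OF cayley_equit_append[OF e0 e1]
      cayley_equit_append[OF e2 e3]] cayley_equit_append[OF cayley_equit_append[OF e4 e5]
      cayley_equit_append[OF e6 e7]]]
  define xs where "xs = [((0, 0, 0), (0, 1)), ((0, 0, 0), (1, 0)), ((0, 0, 0), (1, 1)),
      ((0, 0, 1), (0, 1)), ((0, 1, 0), (1, 0)), ((0, 1, 1), (1, 1)), ((0, 1, 0), (0, 1)),
      ((1, 0, 0), (1, 0)), ((1, 1, 0), (1, 1)), ((0, 1, 1), (0, 1)), ((1, 1, 0), (1, 0)),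
      ((1, 0, 1), (1, 1)), ((1, 0, 0), (0, 1)), ((0, 1, 1), (1, 0)), ((1, 1, 1), (1, 1)),
      ((1, 0, 1), (0, 1)), ((0, 0, 1), (1, 0)), ((1, 0, 0), (1, 1)), ((1, 1, 0), (0, 1)),
      ((1, 1, 1), (1, 0)), ((0, 0, 1), (1, 1)), ((1, 1, 1), (0, 1)), ((1, 0, 1), (1, 0)),
      ((0, 1, 0), (1, 1)) :: (2 \<times> 2 \<times> 2) \<times> 2 \<times> 2]"
  have "cayley_equit 0 8 xs"
    using e by (simp add: xs_def numeral_eq_Suc)
  then show ?thesis
  proof (rule multipartite_cayley)
    show "snd (x + y) = snd x + snd y" for x y
      by (rule snd_add)
    have "\<forall>x. count_list xs x = of_bool (snd x \<noteq> 0)"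
      unfolding split_paired_All forall_2 xs_def by (simp add: zero_prod_def)
    then show "count_list xs x = of_bool (snd x \<noteq> 0)" for x
      by blast
    show "card {x :: (2 \<times> 2 \<times> 2) \<times> 2 \<times> 2. snd x = p} = 8" for p
    proof -
      have "{x :: (2 \<times> 2 \<times> 2) \<times> 2 \<times> 2. snd x = p} = UNIV \<times> {p}"
        by auto
      then show ?thesis
        by (simp only: card_cartesian_product) simp
    qed
  qed
qed

section \<open>Colorings along a family of Doob graphs\<close>

lemma card_cayley_sum: "finite S \<Longrightarrow> card {b. cayley_adj S a b \<and> P b} = (\<Sum>s\<in>S. of_bool (P (s + a)))"
proof -
  assume S: "finite S"
  have "{b. cayley_adj S a b \<and> P b} = {b. cayley_adj S a b} \<inter> {b. P b}"
    by auto
  also have "\<dots> = (\<lambda>s. s + a) ` (S \<inter> {s. P (s + a)})"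
    unfolding cayley_nbrs by auto
  finally show ?thesis
    using S by (simp only: card_image inj_on_add' sum_of_bool_eq of_nat_id)
qed

lemma card_shrikhande_nbrs:
  "card {b. shrikhande_adj (u, v) b \<and> P b} =
    of_bool (P (u, v + 1)) + of_bool (P (u, v + 3)) + of_bool (P (u + 1, v)) + of_bool (P (u + 3,
        v)) +
    of_bool (P (u + 1, v + 1)) + of_bool (P (u + 3, v + 3))"
  unfolding shrikhande_adj_def by (subst card_cayley_sum) (simp_all add: add.commute)

lemma card_K4_nbrs: "card {b. b \<noteq> a \<and> P b} = (\<Sum>b\<in>(UNIV :: 4 set). of_bool (b \<noteq> a \<and> P b))"
  by (simp only: sum_of_bool_eq finite of_nat_id Int_UNIV_left)

section \<open>Small covers from a single factor\<close>

lemma kfold_2_2_shrikhande: "kfold 2 2 1 0"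
  unfolding kfold_def
proof (rule exI[of _ 4], rule equit_1_0)
  \<comment> \<open>The cycle of first coordinates is cut into two arcs of length 2. Two neighbours
    keep the first coordinate, two raise it and two lower it; exactly one of the latter pairs leaves
    the arc.\<close>
  let ?f = "\<lambda>x :: 4 \<times> 4. if fst x = 0 \<or> fst x = 1 then 0 else 1 :: nat"
  have "\<forall>u v. \<forall>c<2. card {b. shrikhande_adj (u, v) b \<and> ?f b = c} = (if ?f (u, v) = c then 4 else 2)"
    unfolding forall_4 card_shrikhande_nbrs by (simp add: numerals_mod All_less_Suc numeral_2_eq_2)
  then show "card {b. shrikhande_adj a b \<and> ?f b = c} = (if ?f a = c then 4 else 2)"
      if "c \<in> {..<2}" for a c
    using that by (cases a) blast
qed auto

lemma kfold_2_4_shrikhande: "kfold 2 4 1 0"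
  unfolding kfold_def
proof (rule exI[of _ 0], rule equit_1_0)
  \<comment> \<open>This is reduction modulo 2: the connection set has two elements in each of the
    three nonzero classes and none in the zero class.\<close>
  let ?f = "\<lambda>x :: 4 \<times> 4. (if parity4 (fst x) = 0 then 0 else 1) + (if parity4 (snd x) =
      0 then 0 else 2 :: nat)"
  have "\<forall>u v. \<forall>c<4. card {b. shrikhande_adj (u, v) b \<and> ?f b = c} = (if ?f (u, v) = c then 0 else 2)"
    unfolding forall_4 card_shrikhande_nbrs by (simp add: numerals_mod All_less_Suc
        eval_nat_numeral)
  then show "card {b. shrikhande_adj a b \<and> ?f b = c} = (if ?f a = c then 0 else 2)"
      if "c \<in> {..<4}" for a c
    using that by (cases a) blast
qed auto

lemma kfold_2_2_hamming: "kfold 2 2 0 1"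
  unfolding kfold_def
proof (rule exI[of _ 1], rule equit_0_1)
  let ?f = "\<lambda>x :: 4. if x = 0 \<or> x = 1 then 0 else 1 :: nat"
  have "\<forall>u. \<forall>c<2. card {b. b \<noteq> u \<and> ?f b = c} = (if ?f u = c then 1 else 2)"
    unfolding forall_4 card_K4_nbrs sum_4 by (simp add: All_less_Suc numeral_2_eq_2)
  then show "card {b. b \<noteq> a \<and> ?f b = c} = (if ?f a = c then 1 else 2)" if "c \<in> {..<2}" for a c
    using that by blast
qed auto

lemma kfold_1_4_hamming: "kfold 1 4 0 1"
  unfolding kfold_def
proof (rule exI[of _ 0], rule equit_0_1)
  show "range idx \<subseteq> {..<4}"
    using idx_less by auto
  fix a c assume "c \<in> {..<4 :: nat}"
  then obtain b where b: "idx b = c"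
    using idx_surj[of c] by auto
  have "{x. x \<noteq> a \<and> idx x = c} = (if b = a then {} else {b})"
    unfolding b[symmetric] by auto
  then show "card {x. x \<noteq> a \<and> idx x = c} = (if idx a = c then 0 else 1)"
    by (auto simp: b[symmetric])
qed simp

text \<open>Quadrupling raises the exponent of two by 2, so each parity needs its own base
  case.\<close>

lemma even_odd_induct [consumes 1, case_names base base' step]:
  assumes "m \<le> (j :: nat)" "P m" "P (Suc m)" "\<And>j. m \<le> j \<Longrightarrow> P j \<Longrightarrow> P (j + 2)"
  shows "P j"
proof -
  have "P j \<and> P (Suc j)"
    using assms(1)
  proof (induction j rule: dec_induct)
    case (step j)
    then show ?case
      using assms(4)[of j] by simp
  qed (use assms in simp)
  then show ?thesis ..
qed

lemma multipartite_power_hamming: "2 \<le> j \<Longrightarrow> \<exists>k. multipartite (2 ^ j) 0 k"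
proof (induction j rule: even_odd_induct)
  case base
  show ?case
    using multipartite_4_hamming by auto
next
  case base'
  show ?case
    using multipartite_8_hamming by (auto simp: numeral_eq_Suc)
next
  case (step j)
  then obtain k where "multipartite (2 ^ j) 0 k" by blast
  from multipartite_step[OF multipartite_4_hamming this] show ?case
    by auto
qed

text \<open>Products of \<open>k * p\<close> Shrikhande factors and \<open>k * q\<close> factors
  \<open>K4\<close>, with \<open>k\<close> left open so that products of such graphs stay within the
  direction. The directions (1, 0) and (0, 1) supply the two extreme graphs from which admissibility
  follows.\<close>

locale direction =
  fixes p q :: nat
  assumes multipartite_4: "\<exists>k. multipartite 4 (k * p) (k * q)"
    and multipartite_8: "\<exists>k. multipartite 8 (k * p) (k * q)"
    and kfold_2_2: "\<exists>k. kfold 2 2 (k * p) (k * q)"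
    and kfold_2_4: "\<exists>k. kfold 2 4 (k * p) (k * q)"
begin

lemma multipartite_power: "2 \<le> j \<Longrightarrow> \<exists>k. multipartite (2 ^ j) (k * p) (k * q)"
proof (induction j rule: even_odd_induct)
  case base
  show ?case
    using multipartite_4 by simp
next
  case base'
  have "2 ^ Suc 2 = (8 :: nat)" by simp
  then show ?case
    using multipartite_8 by (simp only:)
next
  case (step j)
  obtain k where k: "multipartite 4 (k * p) (k * q)"
    using multipartite_4 by blast
  \<comment> \<open>The outer coloring is taken on a Hamming graph whatever the direction; only the
    blocks of \<open>k\<close> belong to it.\<close>
  obtain l where "multipartite (2 ^ j) 0 l"
    using multipartite_power_hamming[OF step(1)] by blast
  from multipartite_step[OF k this] have "multipartite (2 ^ (j + 2)) ((l * k) * p) ((l * k) * q)"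
    by (simp add: mult.assoc)
  then show ?case by blast
qed

lemma kfold_2_power: "1 \<le> j \<Longrightarrow> \<exists>k. kfold 2 (2 ^ j) (k * p) (k * q)"
proof (induction j rule: even_odd_induct)
  case base
  show ?case
    using kfold_2_2 by simp
next
  case base'
  have "2 ^ Suc 1 = (4 :: nat)" by simp
  then show ?case
    using kfold_2_4 by (simp only:)
next
  case (step j)
  then obtain k where k: "kfold 2 (2 ^ j) (k * p) (k * q)" by blast
  obtain l where "multipartite (2 ^ Suc j) (l * p) (l * q)"
    using multipartite_power[of "Suc j"] step(1) by auto
  then have "kfold 2 (4 * 2 ^ j) (k * p + l * p) (k * q + l * q)"
    by (intro kfold_step[OF k]) simp_all
  then have "kfold 2 (2 ^ (j + 2)) ((k + l) * p) ((k + l) * q)"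
    by (simp add: algebra_simps)
  then show ?case by blast
qed

lemma kfold_add_dir:
  assumes "\<exists>k. kfold g (2 ^ j) (k * p) (k * q)" "\<exists>k. kfold g' (2 ^ j) (k * p) (k * q)"
  shows "\<exists>k. kfold (g + g') (2 ^ j) (k * p) (k * q)"
proof -
  obtain k l where "kfold g (2 ^ j) (k * p) (k * q)" "kfold g' (2 ^ j) (l * p) (l * q)"
    using assms by blast
  from kfold_add[OF this] have "kfold (g + g') (2 ^ j) ((k + l) * p) ((k + l) * q)"
    by (simp add: algebra_simps)
  then show ?thesis by blast
qed

text \<open>Multiplicities 2 and 3 generate all larger ones. The 3-fold cover comes from forgetting
  the parts of \<open>K(q,q,q,q)\<close>, which requires q to be at least 4.\<close>

lemma kfold_power:
  assumes "2 \<le> j" "2 \<le> g"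
  shows "\<exists>k. kfold g (2 ^ j) (k * p) (k * q)"
  using assms(2)
proof (induction g rule: even_odd_induct)
  case base
  show ?case
    using kfold_2_power assms(1) by simp
next
  case base'
  obtain k where "multipartite (2 ^ j) (k * p) (k * q)"
    using multipartite_power[OF assms(1)] by blast
  moreover have "Suc 2 = 3" by simp
  ultimately show ?case
    using kfold_multipartite by metis
next
  case (step g)
  show ?case
    using kfold_add_dir[OF step(2) kfold_2_power[of j]] assms(1) by simp
qed

text \<open>This serves exponent 1, where the 3-fold cover is missing and only sums of 2-fold covers
  are at hand.\<close>

lemma kfold_even:
  assumes "1 \<le> j" "1 \<le> i"
  shows "\<exists>k. kfold (2 * i) (2 ^ j) (k * p) (k * q)"
  using assms(2)
proof (induction i rule: dec_induct)
  case base
  show ?case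
    using kfold_2_power[OF assms(1)] by simp
next
  case (step i)
  show ?case
    using kfold_add_dir[OF kfold_2_power[OF assms(1)] step.IH] by simp
qed

text \<open>The \<open>+ 1\<close> is the single \<open>K4\<close> factor, colored injectively, from
  which the quadrupling starts. It is the reason why the coprime case needs one \<open>K4\<close>
  coordinate.\<close>

lemma kfold_1_power:
  "1 \<le> l \<Longrightarrow> \<exists>k. kfold 1 (4 ^ l) (k * p) (k * q + 1)"
proof (induction l rule: dec_induct)
  case base
  have "kfold 1 (4 ^ 1) (0 * p) (0 * q + 1)"
    using kfold_1_4_hamming by simp
  then show ?case by blast
next
  case (step l)
  then obtain k where k: "kfold 1 (4 ^ l) (k * p) (k * q + 1)" by blast
  have "2 \<le> 2 * l" using step(1) by simp
  then obtain i where i: "multipartite (2 ^ (2 * l)) (i * p) (i * q)"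
    using multipartite_power by blast
  have "kfold 1 (4 * 4 ^ l) (k * p + i * p) (k * q + 1 + i * q)"
    by (rule kfold_step[OF k]) (use i in \<open>simp_all add: power_mult\<close>)
  then have "kfold 1 (4 ^ Suc l) ((k + i) * p) ((k + i) * q + 1)"
    by (simp add: algebra_simps)
  then show ?case by blast
qed

end

interpretation shr: direction 1 0
proof
  show "\<exists>k. multipartite 4 (k * 1) (k * 0)" using multipartite_4_shrikhande by auto
  show "\<exists>k. multipartite 8 (k * 1) (k * 0)" using multipartite_8_shrikhande by auto
  show "\<exists>k. kfold 2 2 (k * 1) (k * 0)" using kfold_2_2_shrikhande by auto
  show "\<exists>k. kfold 2 4 (k * 1) (k * 0)" using kfold_2_4_shrikhande by auto
qed

interpretation ham: direction 0 1
proof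
  show "\<exists>k. multipartite 4 (k * 0) (k * 1)" using multipartite_4_hamming by auto
  show "\<exists>k. multipartite 8 (k * 0) (k * 1)" using multipartite_8_hamming by auto
  show "\<exists>k. kfold 2 2 (k * 0) (k * 1)" using kfold_2_2_hamming by auto
  have "kfold (1 + 1) 4 (0 + 0) (1 + 1)"
    by (rule kfold_add[OF kfold_1_4_hamming kfold_1_4_hamming]) simp
  then have "kfold 2 4 (2 * 0) (2 * 1)"
    by (simp add: numeral_2_eq_2)
  then show "\<exists>k. kfold 2 4 (k * 0) (k * 1)" by blast
qed

text \<open>Only the off-diagonal entries are recorded: regularity determines the diagonal, and
  surjectivity follows as soon as \<open>b\<close> and \<open>c\<close> are positive. Constant
  colorings are thus allowed when an entry vanishes, which the families of colorings below
  exploit.\<close>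

definition two_coloring :: "nat \<Rightarrow> nat \<Rightarrow> nat \<Rightarrow> nat \<Rightarrow> bool" where
  "two_coloring b c m n \<longleftrightarrow> (\<exists>\<phi>. \<forall>v\<in>doob_verts m n.
     card {w \<in> doob_nbrs m n v. \<phi> w \<noteq> \<phi> v} = (if \<phi> v then b else c))"

lemma card_doob_nbrs_sum: "card {w \<in> doob_nbrs m n v. P w} = (\<Sum>w\<in>doob_nbrs m n v. of_bool (P w))"
  by (simp only: sum_of_bool_eq finite_doob_nbrs of_nat_id Int_def mem_Collect_eq)

lemma two_coloring_extend:
  assumes "two_coloring b c m n" "m \<le> m'" "n \<le> n'"
  shows "two_coloring b c m' n'"
proof -
  obtain \<phi> where \<phi>: "\<And>v. v \<in> doob_verts m n \<Longrightarrow>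
      card {w \<in> doob_nbrs m n v. \<phi> w \<noteq> \<phi> v} = (if \<phi> v then b else c)"
    using assms(1) unfolding two_coloring_def by blast
  have "card {w \<in> doob_nbrs (m + i) (n + j) v. \<phi> (vleft m n w) \<noteq> \<phi> (vleft m n v)} =
      (if \<phi> (vleft m n v) then b else c)" if "v \<in> doob_verts (m + i) (n + j)" for v i j
    using that
  proof (rule doob_verts_add_cases)
    fix x y assume x: "x \<in> doob_verts m n" and y: "y \<in> doob_verts i j" and v: "v = vjoin x y"
    have x': "x' \<in> doob_verts m n" if "x' \<in> doob_nbrs m n x" for x'
      using that doob_nbrs_subset by blast
    have "(\<Sum>x'\<in>doob_nbrs m n x. of_bool (\<phi> (vleft m n (vjoin x' y)) \<noteq> \<phi> x)) =
        (\<Sum>x'\<in>doob_nbrs m n x. of_bool (\<phi> x' \<noteq> \<phi> x) :: nat)"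
      by (rule sum.cong) (simp_all only: vleft_vjoin[OF x'])
    then show ?thesis
      unfolding v card_doob_nbrs_sum sum_doob_nbrs_vjoin[OF x y] vleft_vjoin[OF x]
      using \<phi>[OF x] unfolding card_doob_nbrs_sum by simp
  qed
  from this[of _ "m' - m" "n' - n"] show ?thesis
    using assms(2,3) unfolding two_coloring_def by (intro exI[of _ "\<lambda>v. \<phi> (vleft m n v)"]) simp
qed

text \<open>The first color collects \<open>c\<close> classes, so that each of its vertices sees the
  \<open>b\<close> other classes \<open>g\<close> times each.\<close>

lemma kfold_two_coloring:
  assumes "kfold g (b + c) m n"
  shows "two_coloring (g * b) (g * c) m n"
proof -
  obtain l f where f: "equitable m n {..<b + c} (\<lambda>x y. if x = y then l else g) f"
    using assms unfolding kfold_def equit_def by blast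
  have "card {w \<in> doob_nbrs m n v. (f w < c) \<noteq> (f v < c)} = (if f v < c then g * b else g * c)"
    if v: "v \<in> doob_verts m n" for v
  proof -
    have "card {w \<in> doob_nbrs m n v. (f w < c) \<noteq> (f v < c)} =
        (\<Sum>x<b + c. (if f v = x then l else g) * of_bool ((x < c) \<noteq> (f v < c)))"
      by (rule equitable_card[OF f v])
    \<comment> \<open>For \<open>x = f v\<close> the indicator vanishes, so the loop weight
      \<open>l\<close> may be replaced by \<open>g\<close>.\<close>
    also have "\<dots> = (\<Sum>x<b + c. g * of_bool ((x < c) \<noteq> (f v < c)))"
      by (rule sum.cong) auto
    also have "\<dots> = g * card ({..<b + c} \<inter> {x. (x < c) \<noteq> (f v < c)})"
      by (simp only: sum_distrib_left[symmetric] sum_of_bool_eq finite_lessThan of_nat_id)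
    also have "{..<b + c} \<inter> {x. (x < c) \<noteq> (f v < c)} = (if f v < c then {c..<b + c} else {..<c})"
      by auto
    finally show ?thesis by simp
  qed
  then show ?thesis
    unfolding two_coloring_def by (intro exI[of _ "\<lambda>v. f v < c"]) blast
qed

lemma doob_verts_nonempty: "doob_verts m n \<noteq> {}"
proof -
  have "(replicate m 0, replicate n 0) \<in> doob_verts m n"
    by (simp add: doob_verts_def)
  then show ?thesis by blast
qed

lemma two_coloring_has_bc_coloring:
  assumes "two_coloring b c m n" "0 < b" "0 < c"
  shows "has_bc_coloring_doob m n b c"
proof -
  obtain \<phi> where \<phi>: "\<And>v. v \<in> doob_verts m n \<Longrightarrow>
      card {w \<in> doob_nbrs m n v. \<phi> w \<noteq> \<phi> v} = (if \<phi> v then b else c)"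
    using assms(1) unfolding two_coloring_def by blast
  obtain d where d: "\<And>v. v \<in> doob_verts m n \<Longrightarrow> card (doob_nbrs m n v) = d"
    using doob_degree by blast
  define f where "f = (\<lambda>v. if \<phi> v then 1 else 2 :: nat)"
  define S where "S = (\<lambda>i j :: nat. if i \<noteq> j then if i = 1 then b else c else if i =
      1 then d - b else d - c)"
  have nb: "{w \<in> doob_verts m n. doob_adj v w \<and> f w = j} = {w \<in> doob_nbrs m n v. f w = j}" for v j
    by (auto simp: doob_nbrs_def)
  have same: "card {w \<in> doob_nbrs m n v. \<phi> w = \<phi> v} = d - (if \<phi> v then b else c)"
      if v: "v \<in> doob_verts m n" for v
  proof -
    have "{w \<in> doob_nbrs m n v. \<phi> w = \<phi> v} = doob_nbrs m n v - {w \<in> doob_nbrs m n v. \<phi> w \<noteq> \<phi> v}"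
      by auto
    then show ?thesis
      using d[OF v] \<phi>[OF v] by (simp add: card_Diff_subset)
  qed
  have cnt: "card {w \<in> doob_verts m n. doob_adj v w \<and> f w = j} = S (f v) j"
    if v: "v \<in> doob_verts m n" and j: "j \<in> {1, 2}" for v j
  proof (cases "j = f v")
    case True
    then have "f w = j \<longleftrightarrow> \<phi> w = \<phi> v" for w
      by (auto simp: f_def)
    then show ?thesis
      unfolding nb using same[OF v] True by (simp add: S_def f_def)
  next
    case False
    then have "f w = j \<longleftrightarrow> \<phi> w \<noteq> \<phi> v" for w
      using j by (auto simp: f_def split: if_splits)
    then show ?thesis
      unfolding nb using \<phi>[OF v] False by (simp add: S_def f_def)
  qed
  have "f ` doob_verts m n = {1, 2}"
  proof -
    obtain v where v: "v \<in> doob_verts m n"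
      using doob_verts_nonempty by blast
    have "card {w \<in> doob_nbrs m n v. \<phi> w \<noteq> \<phi> v} \<noteq> 0"
      using \<phi>[OF v] assms(2,3) by simp
    then have "{w \<in> doob_nbrs m n v. \<phi> w \<noteq> \<phi> v} \<noteq> {}"
      by (rule contrapos_nn) (simp only: card.empty)
    then obtain w where w: "w \<in> doob_verts m n" "\<phi> w \<noteq> \<phi> v"
      using doob_nbrs_subset by blast
    then have "{f v, f w} = {1, 2}"
      by (auto simp: f_def)
    moreover have "f ` doob_verts m n \<subseteq> {1, 2}"
      by (auto simp: f_def)
    ultimately show ?thesis
      using v w(1) by blast
  qed
  then have "perfect_coloring (doob_verts m n) doob_adj {1, 2} S f"
    unfolding perfect_coloring_def using cnt by simp
  moreover have "S 1 2 = b" "S 2 1 = c"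
    by (simp_all add: S_def)
  ultimately show ?thesis
    unfolding has_bc_coloring_doob_def perfect_bc_coloring_def by blast
qed

lemma admissibleI:
  assumes "two_coloring b c m a" "two_coloring b c 0 n" "0 < b" "0 < c"
  shows "admissible a b c"
  unfolding admissible_def
\<comment> \<open>Beyond this threshold either n' is at least n and the coloring of
  \<open>D(0,n)\<close> is padded, or n' < n forces m' >= m and the coloring of
  \<open>D(m,a)\<close> is padded.\<close>
proof (intro exI[of _ "2 * m + n"] allI impI)
  fix m' n' assume *: "2 * m + n \<le> 2 * m' + n' \<and> a \<le> n'"
  have "two_coloring b c m' n'"
  proof (cases "n \<le> n'")
    case True
    then show ?thesis
      by (intro two_coloring_extend[OF assms(2)]) simp_all
  next
    case False
    then show ?thesis
      using * by (intro two_coloring_extend[OF assms(1)]) simp_all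
  qed
  then show "has_bc_coloring_doob m' n' b c"
    using assms(3,4) by (rule two_coloring_has_bc_coloring)
qed

lemma admissible_imp_infty: "admissible a b c \<Longrightarrow> infty_admissible b c"
  unfolding admissible_def infty_admissible_def
proof (elim exE)
  fix D assume D: "\<forall>m n. 2 * m + n \<ge> D \<and> n \<ge> a \<longrightarrow> has_bc_coloring_doob m n b c"
  show "\<exists>N. \<forall>n\<ge>N. has_bc_coloring_doob 0 n b c"
    by (rule exI[of _ "max D a"]) (use D in simp)
qed

lemma admissible_0:
  assumes "\<exists>k. kfold g (b + c) (k * 1) (k * 0)" "\<exists>k. kfold g (b + c) (k * 0) (k * 1)" "0 < g" "0 <
      b" "0 < c"
  shows "admissible 0 (g * b) (g * c)"
proof -
  obtain k l where "kfold g (b + c) (k * 1) (k * 0)" "kfold g (b + c) (l * 0) (l * 1)"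
    using assms by blast
  then have "two_coloring (g * b) (g * c) k 0" "two_coloring (g * b) (g * c) 0 l"
    using kfold_two_coloring by fastforce+
  then show ?thesis
    by (rule admissibleI) (use assms in simp_all)
qed

lemma admissible_1:
  assumes "b + c = 4 ^ l" "0 < b" "0 < c"
  shows "admissible 1 b c"
proof -
  have "1 \<le> l"
    using assms by (cases l) auto
  then obtain k i where "kfold 1 (b + c) (k * 1) (k * 0 + 1)" "kfold 1 (b + c) (i * 0) (i * 1 + 1)"
    unfolding assms(1) using shr.kfold_1_power ham.kfold_1_power by blast
  from this[THEN kfold_two_coloring] have "two_coloring b c k 1" "two_coloring b c 0 (i + 1)"
    by simp_all
  then show ?thesis
    by (rule admissibleI) (use assms in simp_all)
qed

section \<open>Families of translated colorings\<close>

text \<open>Since every vertex has the first color in the same number \<open>t\<close> of the colorings,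
  the coloring used on one factor may be chosen depending on the color of the other factor.\<close>

definition coloring_family :: "nat \<Rightarrow> nat \<Rightarrow> nat \<Rightarrow> nat \<Rightarrow> bool" where
  "coloring_family q t m n \<longleftrightarrow> (\<exists>\<Phi> :: doob_vertex \<Rightarrow> nat \<Rightarrow> bool. \<forall>v\<in>doob_verts m n.
     (\<Sum>a<q. of_bool (\<Phi> v a)) = t \<and>
     (\<forall>a<q. card {w \<in> doob_nbrs m n v. \<Phi> w a \<noteq> \<Phi> v a} = (if \<Phi> v a then q - t else t)))"

lemma sum_of_bool_le: "(\<Sum>a<q. of_bool (P a)) \<le> (q :: nat)"
  using card_mono[of "{..<q}" "{..<q} \<inter> {a. P a}"] by (simp add: sum_of_bool_eq)

lemma sum_of_bool_not: "(\<Sum>a<q. of_bool (\<not> P a)) = q - (\<Sum>a<q. of_bool (P a) :: nat)"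
proof -
  have "(\<Sum>a<q. of_bool (\<not> P a)) + (\<Sum>a<q. of_bool (P a) :: nat) = (\<Sum>a<q. 1)"
    unfolding sum.distrib[symmetric] by (rule sum.cong) auto
  then show ?thesis by simp
qed

lemma sum_of_bool_neq:
  "(\<Sum>a<q. of_bool (P a \<noteq> x)) = (if x then q - (\<Sum>a<q. of_bool (P a)) else (\<Sum>a<q. of_bool (P a) ::
      nat))"
  using sum_of_bool_not[of P q] by (cases x) simp_all

lemma sum_mod_reindex:
  fixes F :: "nat \<Rightarrow> nat"
  assumes "0 < q"
  shows "(\<Sum>a<q. F ((a + b) mod q)) = (\<Sum>a<q. F a)"
  using sum.reindex_bij_betw[OF mod_add_bij[OF assms, of b], of F] .

lemma coloring_family_complement:
  assumes "coloring_family q t m n"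
  shows "coloring_family q (q - t) m n"
proof -
  obtain \<Phi> where \<Phi>: "\<And>v. v \<in> doob_verts m n \<Longrightarrow> (\<Sum>a<q. of_bool (\<Phi> v a)) = t"
    "\<And>v a. v \<in> doob_verts m n \<Longrightarrow> a < q \<Longrightarrow>
      card {w \<in> doob_nbrs m n v. \<Phi> w a \<noteq> \<Phi> v a} = (if \<Phi> v a then q - t else t)"
    using assms unfolding coloring_family_def by blast
  show ?thesis
    unfolding coloring_family_def
  proof (rule exI[of _ "\<lambda>v a. \<not> \<Phi> v a"], intro ballI conjI allI impI)
    fix v assume v: "v \<in> doob_verts m n"
    show "(\<Sum>a<q. of_bool (\<not> \<Phi> v a)) = q - t"
      unfolding sum_of_bool_not \<Phi>(1)[OF v] ..
    have "t \<le> q"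
      using sum_of_bool_le[of "\<Phi> v" q] \<Phi>(1)[OF v] by simp
    fix a assume "a < q"
    from \<Phi>(2)[OF v this]
    show "card {w \<in> doob_nbrs m n v. (\<not> \<Phi> w a) \<noteq> (\<not> \<Phi> v a)} =
        (if \<not> \<Phi> v a then q - (q - t) else q - t)"
      using \<open>t \<le> q\<close> by simp
  qed
qed

lemma coloring_family_two_coloring:
  assumes "coloring_family q t m n" "0 < q"
  shows "two_coloring (q - t) t m n"
proof -
  obtain \<Phi> where "\<And>v a. v \<in> doob_verts m n \<Longrightarrow> a < q \<Longrightarrow>
      card {w \<in> doob_nbrs m n v. \<Phi> w a \<noteq> \<Phi> v a} = (if \<Phi> v a then q - t else t)"
    using assms(1) unfolding coloring_family_def by blast
  then show ?thesis
    unfolding two_coloring_def using assms(2) by (intro exI[of _ "\<lambda>v. \<Phi> v 0"]) blast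
qed

lemma sum_shift_4: "(\<Sum>k<4. F (h + of_nat k)) = (\<Sum>b\<in>(UNIV :: 4 set). F b)" for F :: "4 \<Rightarrow> nat"
proof -
  have "\<forall>h. F (h + of_nat 0) + F (h + of_nat 1) + F (h + of_nat 2) + F (h + of_nat 3) =
      F 0 + F 1 + F 2 + F 3"
    unfolding forall_4 by (simp add: numerals_mod)
  moreover have "(\<Sum>k<4. F (h + of_nat k)) = F (h + of_nat 0) + F (h + of_nat 1) + F (h + of_nat 2)
      + F (h + of_nat 3)"
    by (simp add: eval_nat_numeral)
  ultimately show ?thesis
    unfolding sum_4 by simp
qed

lemma sum_translate_4: "(\<Sum>b\<in>(UNIV :: 4 set). F (b + c)) = (\<Sum>b\<in>UNIV. F b)" for F :: "4 \<Rightarrow> nat"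
  by (rule sum.reindex_bij_witness[of _ "\<lambda>b. b - c" "\<lambda>b. b + c"]) simp_all

lemma coloring_family_step:
  fixes \<tau> :: "4 \<Rightarrow> nat"
  assumes fam: "\<And>b. coloring_family q (\<tau> b) m n" and mult: "multipartite q m' n'" and q: "0 < q"
  shows "coloring_family (4 * q) (\<Sum>b\<in>UNIV. \<tau> b) (m + m') (n + n')"
proof -
  have "\<forall>b. \<exists>\<Phi> :: doob_vertex \<Rightarrow> nat \<Rightarrow> bool. \<forall>v\<in>doob_verts m n.
     (\<Sum>a<q. of_bool (\<Phi> v a)) = \<tau> b \<and>
     (\<forall>a<q. card {w \<in> doob_nbrs m n v. \<Phi> w a \<noteq> \<Phi> v a} = (if \<Phi> v a then q - \<tau> b else \<tau> b))"
    using fam unfolding coloring_family_def by blast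
  from choice[OF this] obtain \<Phi> where \<Phi>: "\<And>b v. v \<in> doob_verts m n \<Longrightarrow> (\<Sum>a<q. of_bool (\<Phi> b v a)) =
      \<tau> b"
    "\<And>b v a. v \<in> doob_verts m n \<Longrightarrow> a < q \<Longrightarrow>
      card {w \<in> doob_nbrs m n v. \<Phi> b w a \<noteq> \<Phi> b v a} = (if \<Phi> b v a then q - \<tau> b else \<tau> b)"
    by blast
  obtain f where f: "equitable m' n' ({..<q} \<times> (UNIV :: 4 set)) (\<lambda>a b. of_bool (snd a \<noteq> snd b)) f"
    using mult unfolding multipartite_def equit_def by blast
  \<comment> \<open>The color (g, h) of the second factor acts on the index \<open>a\<close>: its
    part \<open>h\<close>, rotated by the block number \<open>a div q\<close>, selects one of the
    four families, and \<open>g\<close> rotates the position inside that family. The four blocks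
    thus visit all families, which makes the count at a vertex the sum of the
    \<open>\<tau> b\<close>.\<close>
  define \<Psi> where "\<Psi> = (\<lambda>x c a. \<Phi> (snd c + of_nat (a div q)) x ((a mod q + fst c) mod q))"
  define \<Phi>' where "\<Phi>' = (\<lambda>v a. \<Psi> (vleft m n v) (f (vright m n v)) a)"
  obtain x0 where x0: "x0 \<in> doob_verts m n"
    using doob_verts_nonempty by blast
  have tau_le: "\<tau> b \<le> q" for b
    using sum_of_bool_le[of "\<Phi> b x0" q] \<Phi>(1)[OF x0, of b] by simp
  have main: "(\<Sum>a<4 * q. of_bool (\<Phi>' v a)) = (\<Sum>b\<in>UNIV. \<tau> b) \<and>
      (\<forall>a<4 * q. card {w \<in> doob_nbrs (m + m') (n + n') v. \<Phi>' w a \<noteq> \<Phi>' v a} =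
        (if \<Phi>' v a then 4 * q - (\<Sum>b\<in>UNIV. \<tau> b) else (\<Sum>b\<in>UNIV. \<tau> b)))"
    if "v \<in> doob_verts (m + m') (n + n')" for v
    using that
  proof (rule doob_verts_add_cases)
    fix x y assume x: "x \<in> doob_verts m n" and y: "y \<in> doob_verts m' n'" and v: "v = vjoin x y"
    have \<Phi>'_join: "\<Phi>' (vjoin x' y') a = \<Psi> x' (f y') a" if "x' \<in> doob_verts m n" for x' y' a
      using that by (simp only: \<Phi>'_def vleft_vjoin vright_vjoin)
    have block: "(\<Sum>a = k * q..<k * q + q. of_bool (\<Psi> x c a)) = \<tau> (snd c + of_nat k)" for k c
    proof -
      have "(\<Sum>a = k * q..<k * q + q. of_bool (\<Psi> x c a)) = (\<Sum>a =
          0..<q. of_bool (\<Psi> x c (a + k * q)) :: nat)"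
        using sum.shift_bounds_nat_ivl[of "\<lambda>a. of_bool (\<Psi> x c a) :: nat" 0 "k * q" q]
        by (simp only: add_0_left add.commute)
      also have "\<dots> = (\<Sum>a<q. of_bool (\<Phi> (snd c + of_nat k) x ((a + fst c) mod q)))"
        unfolding atLeast0LessThan by (rule sum.cong) (use q in \<open>simp_all add: \<Psi>_def\<close>)
      also have "\<dots> = (\<Sum>a<q. of_bool (\<Phi> (snd c + of_nat k) x a))"
        by (rule sum_mod_reindex[OF q])
      finally show ?thesis
        unfolding \<Phi>(1)[OF x] .
    qed
    have 1: "(\<Sum>a<4 * q. of_bool (\<Phi>' v a)) = (\<Sum>b\<in>UNIV. \<tau> b)"
      unfolding v \<Phi>'_join[OF x] sum.nat_group[symmetric] block sum_shift_4 ..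
    have 2: "card {w \<in> doob_nbrs (m + m') (n + n') v. \<Phi>' w a \<noteq> \<Phi>' v a} =
        (if \<Phi>' v a then 4 * q - (\<Sum>b\<in>UNIV. \<tau> b) else (\<Sum>b\<in>UNIV. \<tau> b))" if a: "a < 4 * q" for a
    proof -
      define \<beta> :: 4 where "\<beta> = of_nat (a div q)"
      define P where "P = \<Psi> x (f y) a"
      \<comment> \<open>\<open>N b\<close> is the number of colorings in family \<open>b\<close>
        that disagree with \<open>P\<close> at \<open>x\<close>. For the currently selected family
        it is also the number of neighbours of \<open>x\<close> with the other color. Moves in the
        second factor run over all colorings of the other three families, so the two meanings
        combine to the sum of \<open>N\<close> over all four.\<close>
      define N where "N = (\<lambda>b. if P then q - \<tau> b else \<tau> b)"
      have x': "x' \<in> doob_verts m n" if "x' \<in> doob_nbrs m n x" for x'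
        using that doob_nbrs_subset by blast
      have left: "(\<Sum>x'\<in>doob_nbrs m n x. of_bool (\<Phi>' (vjoin x' y) a \<noteq> P)) = N (snd (f y) + \<beta>)"
      proof -
        have "(\<Sum>x'\<in>doob_nbrs m n x. of_bool (\<Phi>' (vjoin x' y) a \<noteq> P)) =
            (\<Sum>x'\<in>doob_nbrs m n x. of_bool (\<Psi> x' (f y) a \<noteq> \<Psi> x (f y) a) :: nat)"
          by (rule sum.cong) (simp_all only: \<Phi>'_join[OF x'] P_def)
        also have "\<dots> = N (snd (f y) + \<beta>)"
          unfolding card_doob_nbrs_sum[symmetric] N_def P_def \<beta>_def \<Psi>_def
              by (rule \<Phi>(2)[OF x]) (simp add: q)
        finally show ?thesis .
      qed
      have "(\<Sum>y'\<in>doob_nbrs m' n' y. of_bool (\<Phi>' (vjoin x y') a \<noteq> P)) =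
          (\<Sum>y'\<in>doob_nbrs m' n' y. of_bool (\<Psi> x (f y') a \<noteq> P) :: nat)"
        by (simp only: \<Phi>'_join[OF x])
      also have "\<dots> = (\<Sum>c\<in>{..<q} \<times> UNIV. of_bool (snd (f y) \<noteq> snd c) * of_bool (\<Psi> x c a \<noteq> P))"
        by (rule equitable_sum[OF f y])
      also have "\<dots> = (\<Sum>b\<in>UNIV. \<Sum>g<q. of_bool (snd (f y) \<noteq> b) * of_bool (\<Phi> (b + \<beta>) x ((g + a mod q)
          mod q) \<noteq> P))"
        unfolding sum.cartesian_product' \<Psi>_def \<beta>_def
            by (subst sum.swap) (simp only: fst_conv snd_conv add.commute[of "a mod q"])
      also have "\<dots> = (\<Sum>b\<in>UNIV. of_bool (snd (f y) \<noteq> b) * N (b + \<beta>))"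
      proof (rule sum.cong)
        fix b :: 4
        have "(\<Sum>g<q. of_bool (\<Phi> (b + \<beta>) x ((g + a mod q) mod q) \<noteq> P)) =
            (\<Sum>g<q. of_bool (\<Phi> (b + \<beta>) x g \<noteq> P) :: nat)"
          by (rule sum_mod_reindex[OF q])
        also have "\<dots> = N (b + \<beta>)"
          unfolding sum_of_bool_neq \<Phi>(1)[OF x] N_def ..
        finally show "(\<Sum>g<q. of_bool (snd (f y) \<noteq> b) * of_bool (\<Phi> (b + \<beta>) x ((g + a mod q) mod q)
            \<noteq> P)) =
            of_bool (snd (f y) \<noteq> b) * N (b + \<beta>)"
          by (simp only: sum_distrib_left[symmetric])
      qed simp
      finally have right: "(\<Sum>y'\<in>doob_nbrs m' n' y. of_bool (\<Phi>' (vjoin x y') a \<noteq> P)) =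
          (\<Sum>b\<in>UNIV. of_bool (snd (f y) \<noteq> b) * N (b + \<beta>))" .
      have "N (snd (f y) + \<beta>) = (\<Sum>b\<in>UNIV. of_bool (snd (f y) = b) * N (b + \<beta>))"
      proof -
        have "(\<Sum>b\<in>UNIV. of_bool (snd (f y) = b) * N (b + \<beta>)) = (\<Sum>b\<in>UNIV. if b =
            snd (f y) then N (b + \<beta>) else 0)"
          by (rule sum.cong) auto
        then show ?thesis by simp
      qed
      then have "N (snd (f y) + \<beta>) + (\<Sum>b\<in>UNIV. of_bool (snd (f y) \<noteq> b) * N (b + \<beta>)) =
          (\<Sum>b\<in>UNIV. N (b + \<beta>))"
        by (simp only: sum.distrib[symmetric] add_mult_distrib[symmetric]) (intro sum.cong, auto)
      also have "\<dots> = (\<Sum>b\<in>UNIV. N b)"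
        by (rule sum_translate_4)
      also have "\<dots> = (if P then 4 * q - (\<Sum>b\<in>UNIV. \<tau> b) else (\<Sum>b\<in>UNIV. \<tau> b))"
        using tau_le[of 0] tau_le[of 1] tau_le[of 2] tau_le[of 3] unfolding N_def sum_4 by auto
      finally show ?thesis
        unfolding v card_doob_nbrs_sum sum_doob_nbrs_vjoin[OF x y] \<Phi>'_join[OF x,
            of y] P_def[symmetric] left right .
    qed
    show ?thesis
      using 1 2 by blast
  qed
  then show ?thesis
    unfolding coloring_family_def by blast
qed

text \<open>Rotating the four colors of the cover gives four colorings, the first color being
  \<open>s\<close> consecutive residues. The indices below 8 list each rotation twice.\<close>

lemma coloring_family_even:
  assumes "kfold 2 4 m n" "s \<le> 4"
  shows "coloring_family 8 (2 * s) m n"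
proof -
  obtain l f where f: "equitable m n {..<4 :: nat} (\<lambda>x y. if x = y then l else 2) f"
    using assms(1) unfolding kfold_def equit_def by blast
  have less: "(\<Sum>x<4. of_bool (x < s)) = s"
  proof -
    have "{..<4} \<inter> {x. x < s} = {..<s}"
      using assms(2) by auto
    then show ?thesis
      by (simp add: sum_of_bool_eq)
  qed
  show ?thesis
    unfolding coloring_family_def
  proof (rule exI[of _ "\<lambda>v a. (a + f v) mod 4 < s"], intro ballI conjI allI impI)
    fix v assume v: "v \<in> doob_verts m n"
    have block: "(\<Sum>a = k * 4..<k * 4 + 4. of_bool ((a + f v) mod 4 < s)) = s" for k
    proof -
      have "(\<Sum>a = k * 4..<k * 4 + 4. of_bool ((a + f v) mod 4 < s)) =
          (\<Sum>a = 0..<4. of_bool ((a + (k * 4 + f v)) mod 4 < s) :: nat)"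
        using sum.shift_bounds_nat_ivl[of "\<lambda>a. of_bool ((a + f v) mod 4 < s) :: nat" 0 "k * 4" 4]
        by (simp only: add_0_left add.commute add.left_commute add.assoc)
      also have "\<dots> = s"
        unfolding atLeast0LessThan
        using sum_mod_reindex[of 4 "\<lambda>x. of_bool (x < s)" "k * 4 + f v"] less by simp
      finally show ?thesis .
    qed
    show "(\<Sum>a<8. of_bool ((a + f v) mod 4 < s)) = 2 * s"
      using sum.nat_group[of "\<lambda>a. of_bool ((a + f v) mod 4 < s) :: nat" 4 2] unfolding block by simp
    fix a :: nat
    define P where "P \<longleftrightarrow> (a + f v) mod 4 < s"
    have "card {w \<in> doob_nbrs m n v. ((a + f w) mod 4 < s) \<noteq> P} =
        (\<Sum>x<4. (if f v = x then l else 2) * of_bool (((a + x) mod 4 < s) \<noteq> P))"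
      by (rule equitable_card[OF f v])
    also have "\<dots> = (\<Sum>x<4. 2 * of_bool (((x + a) mod 4 < s) \<noteq> P))"
      by (rule sum.cong) (auto simp: P_def add.commute)
    also have "\<dots> = 2 * (\<Sum>x<4. of_bool ((x < s) \<noteq> P))"
      unfolding sum_distrib_left[symmetric] sum_mod_reindex[of 4 "\<lambda>x. of_bool ((x < s) \<noteq> P)" a,
          OF zero_less_numeral] ..
    also have "\<dots> = (if P then 8 - 2 * s else 2 * s)"
      unfolding sum_of_bool_neq less by (simp add: diff_mult_distrib2)
    finally show "card {w \<in> doob_nbrs m n v. ((a + f w) mod 4 < s) \<noteq> ((a + f v) mod 4 < s)} =
        (if (a + f v) mod 4 < s then 8 - 2 * s else 2 * s)"
      unfolding P_def .
  qed
qed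

section \<open>The case of an odd power of two\<close>

text \<open>Here \<open>K4\<close> is the Cayley graph of the cyclic group, so that a set in the
  cube of the residues modulo 4 can be translated by group elements.\<close>

lemma cayley_equit_K4_cyclic:
  fixes x :: "'h::{ab_group_add, finite}"
  assumes x: "x + x + x + x = 0"
  shows "cayley_equit 0 1 [x, x + x, x + x + x]"
  unfolding cayley_equit_def
proof (rule equit_0_1[of _ "smult4 x"])
  let ?S = "{1, 2, 3} :: 4 set"
  fix a :: 4 and c :: 'h
  have "\<forall>d::4. d \<in> ?S \<longleftrightarrow> d \<noteq> 0"
    unfolding forall_4 by simp
  then have adj: "b \<noteq> a \<longleftrightarrow> cayley_adj ?S a b" for b
    unfolding cayley_adj_def by simp
  have sum_S: "(\<Sum>s\<in>?S. F s) = F 3 + F 2 + F 1" for F :: "4 \<Rightarrow> nat"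
    by simp
  have count: "count_list [b, d, e] z = of_bool (e = z) + of_bool (d = z) + of_bool (b = z)"
      for b d e z :: 'h
    by simp
  have "card {b. b \<noteq> a \<and> smult4 x b = c} = card {s \<in> ?S. smult4 x s = c - smult4 x a}"
    unfolding adj by (rule card_cayley_hom) (rule smult4_add[OF x])
  also have "\<dots> = (\<Sum>s\<in>?S. of_bool (smult4 x s = c - smult4 x a))"
    by (simp only: sum_of_bool_eq finite_insert finite.emptyI of_nat_id Int_def mem_Collect_eq)
  also have "\<dots> = count_list [x, x + x, x + x + x] (c - smult4 x a)"
    unfolding sum_S count smult4_simps ..
  finally show "card {b. b \<noteq> a \<and> smult4 x b = c} = count_list [x, x + x,
      x + x + x] (c - smult4 x a)" .
qed simp_all

lemma sum_count_list:
  fixes F :: "'h::{ab_group_add, finite} \<Rightarrow> nat"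
  shows "(\<Sum>x\<in>UNIV. count_list xs (x - c) * F x) = (\<Sum>l\<leftarrow>xs. F (c + l))"
proof (induction xs)
  case (Cons l xs)
  have "(\<Sum>x\<in>UNIV. count_list (l # xs) (x - c) * F x) =
      (\<Sum>x\<in>UNIV. (if x = c + l then F x else 0) + count_list xs (x - c) * F x)"
    by (rule sum.cong) (auto simp: eq_diff_eq add.commute)
  then show ?case
    using Cons by (simp add: sum.distrib)
qed simp

text \<open>A perfect \<open>(5,3)\<close>-coloring of \<open>H(3,4)\<close>, found by computer search, whose translates by
  the subgroup \<open>{0,2} \<times> \<int>\<^sub>4 \<times> {0}\<close> cover every vertex exactly three times.\<close>

definition set_53 :: "4 \<times> 4 \<times> 4 \<Rightarrow> bool" where
  "set_53 v = (case v of (x, y, z) \<Rightarrow>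
     if (z, y) \<in> {(0, 0), (2, 0), (3, 0)} then x = 1 \<or> x = 2
     else if (z, y) \<in> {(1, 1), (1, 2), (1, 3)} then x = 0 \<or> x = 3
     else (z, y) \<in> {(0, 3), (2, 2), (3, 1)})"

lemma set_53_simps:
  "set_53 (x, 0, 0) \<longleftrightarrow> x = 1 \<or> x = 2"
  "set_53 (x, 1, 0) \<longleftrightarrow> False"
  "set_53 (x, 2, 0) \<longleftrightarrow> False"
  "set_53 (x, 3, 0) \<longleftrightarrow> True"
  "set_53 (x, 0, 1) \<longleftrightarrow> False"
  "set_53 (x, 1, 1) \<longleftrightarrow> x = 0 \<or> x = 3"
  "set_53 (x, 2, 1) \<longleftrightarrow> x = 0 \<or> x = 3"
  "set_53 (x, 3, 1) \<longleftrightarrow> x = 0 \<or> x = 3"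
  "set_53 (x, 0, 2) \<longleftrightarrow> x = 1 \<or> x = 2"
  "set_53 (x, 1, 2) \<longleftrightarrow> False"
  "set_53 (x, 2, 2) \<longleftrightarrow> True"
  "set_53 (x, 3, 2) \<longleftrightarrow> False"
  "set_53 (x, 0, 3) \<longleftrightarrow> x = 1 \<or> x = 2"
  "set_53 (x, 1, 3) \<longleftrightarrow> True"
  "set_53 (x, 2, 3) \<longleftrightarrow> False"
  "set_53 (x, 3, 3) \<longleftrightarrow> False"
  by (simp_all add: set_53_def)

lemma coloring_family_3: "coloring_family 8 3 0 3"
proof -
  define dirs :: "(4 \<times> 4 \<times> 4) list" where
    "dirs = [(1, 0, 0), (2, 0, 0), (3, 0, 0), (0, 1, 0), (0, 2, 0), (0, 3, 0), (0, 0, 1),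
        (0, 0, 2), (0, 0, 3)]"
  have 1: "cayley_equit 0 1 ([(1, 0, 0), (2, 0, 0), (3, 0, 0)] :: (4 \<times> 4 \<times> 4) list)"
    using cayley_equit_K4_cyclic[of "(1, 0, 0) :: 4 \<times> 4 \<times> 4"]
        by (simp add: zero_prod_def numerals_mod)
  have 2: "cayley_equit 0 1 ([(0, 1, 0), (0, 2, 0), (0, 3, 0)] :: (4 \<times> 4 \<times> 4) list)"
    using cayley_equit_K4_cyclic[of "(0, 1, 0) :: 4 \<times> 4 \<times> 4"]
        by (simp add: zero_prod_def numerals_mod)
  have 3: "cayley_equit 0 1 ([(0, 0, 1), (0, 0, 2), (0, 0, 3)] :: (4 \<times> 4 \<times> 4) list)"
    using cayley_equit_K4_cyclic[of "(0, 0, 1) :: 4 \<times> 4 \<times> 4"]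
        by (simp add: zero_prod_def numerals_mod)
  have "cayley_equit 0 3 dirs"
    using cayley_equit_append[OF 1 cayley_equit_append[OF 2 3]]
        by (simp add: dirs_def numeral_eq_Suc)
  then obtain f where f: "equitable 0 3 (UNIV :: (4 \<times> 4 \<times> 4) set) (\<lambda>x y. count_list dirs (y - x)) f"
    unfolding cayley_equit_def equit_def by blast
  define shifts :: "(4 \<times> 4 \<times> 4) list" where
    "shifts = [(0, 0, 0), (0, 1, 0), (0, 2, 0), (0, 3, 0), (2, 0, 0), (2, 1, 0), (2, 2, 0),
        (2, 3, 0)]"
  define shift where "shift = (\<lambda>a. shifts ! a)"
  have length: "length shifts = 8"
    by (simp add: shifts_def)
  \<comment> \<open>For fixed y and z the set is empty, full, or one of the pairs {1,2} and {0,3} in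
    the first coordinate. Adding 2 exchanges these pairs, so the shifts by 0 and 2 together cover a
    point 0, 2 or 1 times. For each z the four values of y contribute 1 + 2 or 1 + 1 + 1.\<close>
  have all: "\<forall>c. (\<Sum>l\<leftarrow>shifts. of_bool (set_53 (c + l))) = (3 :: nat)"
    unfolding split_paired_All forall_4 shifts_def by (simp add: set_53_simps numerals_mod)
  have eq: "(\<Sum>a<8. of_bool (set_53 (c + shift a))) = (\<Sum>l\<leftarrow>shifts. of_bool (set_53 (c + l)) :: nat)"
      for c
    unfolding sum_list_sum_nth length_map length atLeast0LessThan
    by (rule sum.cong) (simp_all add: shift_def length)
  have count: "(\<Sum>a<8. of_bool (set_53 (c + shift a))) = (3 :: nat)" for c
    by (rule trans[OF eq spec[OF all]])
  have "\<forall>c. (\<Sum>l\<leftarrow>dirs. of_bool (set_53 (c + l) \<noteq> set_53 c)) = (if set_53 c then 5 else 3 :: nat)"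
    unfolding split_paired_All forall_4 dirs_def by (simp add: set_53_simps numerals_mod)
  then have nbrs: "(\<Sum>l\<leftarrow>dirs. of_bool (set_53 (c + l) \<noteq> set_53 c)) =
      (if set_53 c then 5 else 3 :: nat)" for c
    by blast
  show ?thesis
    unfolding coloring_family_def
  proof (rule exI[of _ "\<lambda>v a. set_53 (f v + shift a)"], intro ballI conjI allI impI)
    fix v assume v: "v \<in> doob_verts 0 3"
    show "(\<Sum>a<8. of_bool (set_53 (f v + shift a))) = (3 :: nat)"
      by (rule count)
    fix a :: nat
    have "card {w \<in> doob_nbrs 0 3 v. set_53 (f w + shift a) \<noteq> set_53 (f v + shift a)} =
        (\<Sum>x\<in>UNIV. count_list dirs (x - f v) * of_bool (set_53 (x + shift a) \<noteq> set_53 (f v + shift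
            a)))"
      by (rule equitable_card[OF f v])
    also have "\<dots> = (\<Sum>l\<leftarrow>dirs. of_bool (set_53 (f v + shift a + l) \<noteq> set_53 (f v + shift a)))"
      unfolding sum_count_list by (simp only: add.assoc add.commute[of _ "shift a"])
    also have "\<dots> = (if set_53 (f v + shift a) then 5 else 3)"
      by (rule nbrs)
    finally show "card {w \<in> doob_nbrs 0 3 v. set_53 (f w + shift a) \<noteq> set_53 (f v + shift a)} =
        (if set_53 (f v + shift a) then 8 - 3 else 3)"
      by simp
  qed
qed

text \<open>The even values come from the rotated 2-fold cover, 3 from the special coloring and 5
  from its complement. The values 1 and 7 would give a perfect (7,1)-coloring, possibly after
  exchanging the colors, although 3 does not divide 7.\<close>

lemma coloring_family_8:
  assumes "t \<le> 8" "t \<noteq> 1" "t \<noteq> 7"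
  shows "coloring_family 8 t 0 3"
proof -
  have "kfold (1 + 1) 4 (0 + 0) (1 + 1)"
    by (rule kfold_add[OF kfold_1_4_hamming kfold_1_4_hamming]) simp
  then have "kfold 2 4 0 3"
    using kfold_extend[of 2 4 0 2 0 3] by (simp add: numeral_2_eq_2)
  note even = coloring_family_even[OF this]
  have "coloring_family 8 0 0 3" "coloring_family 8 2 0 3" "coloring_family 8 4 0 3"
    "coloring_family 8 6 0 3" "coloring_family 8 8 0 3"
    using even[of 0] even[of 1] even[of 2] even[of 3] even[of 4] by simp_all
  moreover have "coloring_family 8 5 0 3"
    using coloring_family_complement[OF coloring_family_3] by simp
  moreover have "t = 0 \<or> t = 2 \<or> t = 3 \<or> t = 4 \<or> t = 5 \<or> t = 6 \<or> t = 8"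
    using assms by linarith
  ultimately show ?thesis
    using coloring_family_3 by (elim disjE) (simp_all only:)
qed

text \<open>The two excluded values correspond to perfect \<open>(q - 1, 1)\<close>-colorings, which need not exist.\<close>

definition splittable :: "nat \<Rightarrow> nat \<Rightarrow> bool" where
  "splittable q t \<longleftrightarrow> t \<le> q \<and> t \<noteq> 1 \<and> t + 1 \<noteq> q"

lemma splittable_split:
  assumes q: "8 \<le> q" and t: "splittable (4 * q) t"
  obtains t0 t1 t2 t3 where "splittable q t0" "splittable q t1" "splittable q t2" "splittable q t3"
    "t = t0 + t1 + t2 + t3"
proof -
  define d r where "d = t div q" and "r = t mod q"
  have t_eq: "t = q * d + r" and r: "r < q"
    using q by (simp_all add: d_def r_def)
  \<comment> \<open>As \<open>q\<close> is at least 8, none of these numbers equals 1 or q -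
    1.\<close>
  have s: "splittable q 0" "splittable q q" "splittable q 2" "splittable q 3" "splittable q (q -
      2)" "splittable q (q - 3)"
    using q by (auto simp: splittable_def)
  have "q * d \<le> q * 4"
    using t unfolding splittable_def t_eq by linarith
  then have d4: "d \<le> 4"
    using q by (simp only: mult_le_cancel1)
  have pick: "\<exists>t1 t2 t3. splittable q t1 \<and> splittable q t2 \<and> splittable q t3 \<and> q * i =
      t1 + t2 + t3" if i: "i \<le> 3" for i
  proof -
    have "i = 0 \<or> i = 1 \<or> i = 2 \<or> i = 3"
      using i by linarith
    then consider "i = 0" | "i = 1" | "i = 2" | "i = 3"
      by blast
    then show ?thesis
    proof cases
      case 1 then show ?thesis by (intro exI[of _ 0] conjI s) simp
    next
      case 2 then show ?thesis by (intro exI[of _ q] exI[of _ 0] conjI s) simp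
    next
      case 3 then show ?thesis
        by (intro exI[of _ q] exI[of _ q] exI[of _ 0] conjI s) simp
    next
      case 4 then show ?thesis by (intro exI[of _ q] conjI s) simp
    qed
  qed
  have pick2: "\<exists>t1 t2. splittable q t1 \<and> splittable q t2 \<and> q * i = t1 + t2" if i: "i \<le> 2" for i
  proof -
    have "i = 0 \<or> i = 1 \<or> i = 2"
      using i by linarith
    then consider "i = 0" | "i = 1" | "i = 2"
      by blast
    then show ?thesis
    proof cases
      case 1 then show ?thesis by (intro exI[of _ 0] conjI s) simp
    next
      case 2 then show ?thesis by (intro exI[of _ q] exI[of _ 0] conjI s) simp
    next
      case 3 then show ?thesis by (intro exI[of _ q] conjI s) simp
    qed
  qed
  have "d = 4 \<or> d \<le> 3 \<and> splittable q r \<or> d \<le> 3 \<and> r = 1 \<or> d \<le> 3 \<and> r + 1 = q"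
    using d4 r unfolding splittable_def by linarith
  then consider "d = 4" | "d \<le> 3" "splittable q r" | "d \<le> 3" "r = 1" | "d \<le> 3" "r + 1 = q"
    by blast
  then show thesis
  proof cases
    case 1
    then have "t = q + q + q + q"
      using t t_eq unfolding splittable_def by simp
    then show thesis
      using that s by blast
  next
    case 2
    then show thesis
      using pick[of d] that t_eq by (metis add.assoc add.commute)
  next
    case 3
    have "d \<noteq> 0"
      using t t_eq 3 by (auto simp: splittable_def)
    then obtain i where i: "d = Suc i" "i \<le> 2"
      using 3 by (cases d) auto
    obtain t1 t2 where "splittable q t1" "splittable q t2" "q * i = t1 + t2"
      using pick2[OF i(2)] by blast
    \<comment> \<open>A remainder 1 borrows a full part: q + 1 = (q - 2) + 3. There is one to borrow
      because t is not 1.\<close>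
    moreover from this have "t = t1 + t2 + (q - 2) + 3"
      using t_eq 3 i q by simp
    ultimately show thesis
      using that s by blast
  next
    case 4
    have "d \<noteq> 3"
    proof
      assume "d = 3"
      then have "t + 1 = 4 * q"
        using t_eq 4 by simp
      then show False
        using t by (simp add: splittable_def)
    qed
    then have "d \<le> 2"
      using 4 by simp
    from pick2[OF this] obtain t1 t2 where "splittable q t1" "splittable q t2" "q * d = t1 + t2"
      by blast
    \<comment> \<open>The remainder is split as q - 1 = (q - 3) + 2. This takes two of the four
      parts, and the other two suffice because t is not 4q - 1.\<close>
    moreover from this have "t = t1 + t2 + (q - 3) + 2"
      using t_eq 4 q by simp
    ultimately show thesis
      using that s by blast
  qed
qed

text \<open>One \<open>k\<close> serves all \<open>t\<close>, since the step combines four families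
  with different parameters on the same factor. The three additional \<open>K4\<close> coordinates
  carry the colorings for q = 8.\<close>

lemma (in direction) coloring_family_power:
  "\<exists>k. \<forall>t. splittable (8 * 4 ^ i) t \<longrightarrow> coloring_family (8 * 4 ^ i) t (k * p) (k * q + 3)"
proof (induction i)
  case 0
  have "\<forall>t. splittable (8 * 4 ^ 0) t \<longrightarrow> coloring_family (8 * 4 ^ 0) t (0 * p) (0 * q + 3)"
    using coloring_family_8 by (simp add: splittable_def)
  then show ?case by blast
next
  case (Suc i)
  let ?q = "8 * 4 ^ i :: nat"
  obtain k where k: "\<And>t. splittable ?q t \<Longrightarrow> coloring_family ?q t (k * p) (k * q + 3)"
    using Suc by blast
  have pow: "2 ^ (2 * i + 3) = ?q"
    by (simp add: power_add power_mult)
  obtain j where j: "multipartite ?q (j * p) (j * q)"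
    using multipartite_power[of "2 * i + 3"] unfolding pow by auto
  have "coloring_family (8 * 4 ^ Suc i) t ((k + j) * p) ((k + j) * q + 3)"
      if t: "splittable (8 * 4 ^ Suc i) t" for t
  proof -
    have t': "splittable (4 * ?q) t"
      using t by simp
    obtain t0 t1 t2 t3 where s: "splittable ?q t0" "splittable ?q t1" "splittable ?q t2"
        "splittable ?q t3"
      and t: "t = t0 + t1 + t2 + t3"
      by (rule splittable_split[OF _ t']) simp
    define \<tau> :: "4 \<Rightarrow> nat" where "\<tau> = (\<lambda>b. if b = 0 then t0 else if b = 1 then t1 else if b =
        2 then t2 else t3)"
    have "splittable ?q (\<tau> b)" for b
      using s by (simp add: \<tau>_def)
    then have "coloring_family (4 * ?q) (\<Sum>b\<in>UNIV. \<tau> b) (k * p + j * p) (k * q + 3 + j * q)"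
      by (intro coloring_family_step[OF k j]) simp_all
    moreover have "(\<Sum>b\<in>UNIV. \<tau> b) = t"
      unfolding sum_4 t by (simp add: \<tau>_def)
    ultimately show ?thesis
      by (simp add: algebra_simps)
  qed
  then show ?case by blast
qed

lemma admissible_8:
  assumes "b + c = 8 * 4 ^ i" "2 \<le> b" "2 \<le> c"
  shows "admissible 8 b c"
proof -
  have s: "splittable (8 * 4 ^ i) c"
    unfolding assms(1)[symmetric] splittable_def using assms(2,3) by simp
  obtain k where "coloring_family (8 * 4 ^ i) c (k * 1) (k * 0 + 3)"
    using shr.coloring_family_power[of i] s by blast
  moreover obtain l where "coloring_family (8 * 4 ^ i) c (l * 0) (l * 1 + 3)"
    using ham.coloring_family_power[of i] s by blast
  moreover have "8 * 4 ^ i - c = b"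
    unfolding assms(1)[symmetric] by simp
  ultimately have "two_coloring b c k 3" "two_coloring b c 0 (l + 3)"
    using coloring_family_two_coloring[of "8 * 4 ^ i" c] by fastforce+
  \<comment> \<open>The coloring built with Shrikhande factors uses three \<open>K4\<close>
    coordinates; the further five are ignored by it.\<close>
  then show ?thesis
    using assms(2,3) by (intro admissibleI[of b c k 8 "l + 3"]) (auto elim: two_coloring_extend)
qed

section \<open>Necessity\<close>

lemma doob_adj_hamming [simp]: "doob_adj ([], zs) ([], ws) \<longleftrightarrow> cart_power_adj K4_adj zs ws"
  by (simp add: doob_adj_def)

lemma K4_power_adj_sym: "cart_power_adj K4_adj zs ws \<longleftrightarrow> cart_power_adj K4_adj ws zs"
  using cart_power_adj_sym[of K4_adj] K4_adj_sym by blast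

lemma doob_verts_hamming: "doob_verts 0 n = Pair [] ` {zs. length zs = n}"
  by (auto simp: doob_verts_def)

lemma card_doob_verts_hamming: "card (doob_verts 0 n) = 4 ^ n"
proof -
  have "card {zs :: 4 list. length zs = n} = 4 ^ n"
    using card_lists_length_eq[of "UNIV :: 4 set" n] by simp
  then show ?thesis
    unfolding doob_verts_hamming by (simp add: card_image inj_on_def)
qed

section \<open>Edge counting between the two colors\<close>

lemma perfect_coloring_card:
  assumes "perfect_coloring V R C S f" "v \<in> V" "f v \<in> C" "j \<in> C"
  shows "card {w \<in> V. R v w \<and> f w = j} = S (f v) j"
  using assms unfolding perfect_coloring_def by blast

text \<open>The witness is the number of vertices of the first color.\<close>

lemma bc_coloring_density:
  assumes "has_bc_coloring_doob 0 n b c"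
  shows "\<exists>x. (b + c) * x = c * 4 ^ n"
proof -
  obtain f S where f: "perfect_coloring (doob_verts 0 n) doob_adj {1, 2 :: nat} S f" and S: "S 1 2
      = b" "S 2 1 = c"
    using assms unfolding has_bc_coloring_doob_def perfect_bc_coloring_def by blast
  define V where "V = (\<lambda>i :: nat. {v \<in> doob_verts 0 n. f v = i})"
  have fin: "finite (V i)" for i
    by (simp add: V_def)
  have cnt: "(\<Sum>w\<in>V j. of_bool (doob_adj v w)) = S i j" if "i \<in> {1, 2}" "j \<in> {1, 2}" "v \<in> V i"
      for i j v
  proof -
    have "card {w \<in> doob_verts 0 n. doob_adj v w \<and> f w = j} = S i j"
      using f that unfolding perfect_coloring_def V_def by blast
    moreover have "{w \<in> doob_verts 0 n. doob_adj v w \<and> f w = j} = V j \<inter> {w. doob_adj v w}"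
      by (auto simp: V_def)
    ultimately show ?thesis
      using fin by (simp add: sum_of_bool_eq)
  qed
  have sym: "doob_adj v w \<longleftrightarrow> doob_adj w v" if "v \<in> V i" "w \<in> V j" for v w i j
    using that K4_power_adj_sym by (auto simp: V_def doob_verts_hamming)
  have "card (V 1) * b = (\<Sum>v\<in>V 1. \<Sum>w\<in>V 2. of_bool (doob_adj v w))"
    by (simp add: cnt[of 1 2] S del: sum_of_bool_eq One_nat_def)
  also have "\<dots> = (\<Sum>w\<in>V 2. \<Sum>v\<in>V 1. of_bool (doob_adj w v))"
    by (subst sum.swap) (intro sum.cong refl arg_cong[where f = of_bool] sym)
  also have "\<dots> = card (V 2) * c"
    by (simp add: cnt[of 2 1] S del: sum_of_bool_eq One_nat_def)
  finally have edges: "card (V 1) * b = card (V 2) * c" .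
  have "V 1 \<union> V 2 = doob_verts 0 n" "V 1 \<inter> V 2 = {}"
    using f by (auto simp: V_def perfect_coloring_def)
  then have "card (V 1) + card (V 2) = 4 ^ n"
    using card_Un_disjoint[OF fin fin, of 1 2] card_doob_verts_hamming by simp
  then have "(b + c) * card (V 1) = c * 4 ^ n"
    using edges by (simp add: algebra_simps flip: \<open>card (V 1) + card (V 2) = 4 ^ n\<close>)
  then show ?thesis by blast
qed

lemma infty_admissible_power_2:
  assumes "infty_admissible b c" "0 < b" "0 < c"
  shows "\<exists>l. (b + c) div gcd b c = 2 ^ l"
proof -
  obtain N where "has_bc_coloring_doob 0 N b c"
    using assms(1) unfolding infty_admissible_def by blast
  then obtain x where x: "(b + c) * x = c * 4 ^ N"
    using bc_coloring_density by blast
  define g b' c' where "g = gcd b c" and "b' = b div g" and "c' = c div g"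
  have g: "0 < g" "b = g * b'" "c = g * c'"
    using assms(2,3) by (simp_all add: g_def b'_def c'_def)
  have cop: "coprime b' c'"
    unfolding b'_def c'_def g_def by (rule div_gcd_coprime) (use assms in simp)
  have "g * ((b' + c') * x) = g * (c' * 4 ^ N)"
    using x unfolding g(2,3) by (simp only: distrib_left[symmetric] mult.assoc)
  then have "(b' + c') * x = c' * 4 ^ N"
    using g(1) by simp
  then have "b' + c' dvd c' * 4 ^ N"
    by (metis dvd_triv_left)
  \<comment> \<open>After division by the gcd, b' + c' is coprime to c' and must divide the power of
    4 alone.\<close>
  moreover have "coprime (b' + c') c'"
    using cop unfolding coprime_iff_gcd_eq_1 by simp
  ultimately have "b' + c' dvd 4 ^ N"
    by (simp add: coprime_dvd_mult_right_iff)
  also have "(4 :: nat) ^ N = 2 ^ (2 * N)"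
    by (simp add: power_mult)
  finally obtain l where "b' + c' = 2 ^ l"
    using divides_primepow_nat[OF two_is_prime_nat] by blast
  moreover have "(b + c) div g = b' + c'"
    using g(1) unfolding g(2,3) by (simp flip: distrib_left)
  ultimately show ?thesis
    unfolding g_def by auto
qed

text \<open>The neighbours of \<open>zs\<close> form one line per coordinate, each with three
  pairwise adjacent points besides \<open>zs\<close>. The assumption makes \<open>P\<close> constant
  on each line, and the induction splits off the line of the first coordinate.\<close>

lemma three_dvd_card_K4_power_nbrs:
  assumes "\<And>ws ws'. cart_power_adj K4_adj zs ws \<Longrightarrow> cart_power_adj K4_adj zs ws' \<Longrightarrow>
    cart_power_adj K4_adj ws ws' \<Longrightarrow> P ws = P ws'"
  shows "3 dvd card {ws. cart_power_adj K4_adj zs ws \<and> P ws}"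
  using assms
proof (induction zs arbitrary: P)
  case (Cons z zs)
  let ?A = "{d. d \<noteq> z \<and> P (d # zs)}" and ?B = "{ws. cart_power_adj K4_adj zs ws \<and> P (z # ws)}"
  have split: "{ws. cart_power_adj K4_adj (z # zs) ws \<and> P ws} = (\<lambda>d. d # zs) ` ?A \<union> (#) z ` ?B"
  proof (rule set_eqI)
    fix ws
    show "ws \<in> {ws. cart_power_adj K4_adj (z # zs) ws \<and> P ws} \<longleftrightarrow> ws \<in> (\<lambda>d. d # zs) ` ?A \<union> (#) z ` ?B"
    proof (cases ws)
      case Nil
      then show ?thesis by (auto simp: cart_power_adj_def)
    next
      case (Cons w ws')
      then show ?thesis by (auto simp: cart_power_adj_Cons K4_adj_def)
    qed
  qed
  have "finite ?B"
    by (rule finite_subset[OF _ finite_length[of "length zs"]]) (auto dest: cart_power_adj_length)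
  moreover have "(\<lambda>d. d # zs) ` ?A \<inter> (#) z ` ?B = {}"
    by auto
  ultimately have "card {ws. cart_power_adj K4_adj (z # zs) ws \<and> P ws} = card ?A + card ?B"
    unfolding split by (subst card_Un_disjoint) (simp_all add: card_image inj_on_def)
  moreover have "3 dvd card ?A"
  proof (cases "?A = {}")
    case True
    then show ?thesis by (simp only: card.empty dvd_0_right)
  next
    case False
    then obtain d where d: "d \<noteq> z" "P (d # zs)" by blast
    have "P (e # zs)" if "e \<noteq> z" for e
    proof (cases "e = d")
      case False
      then show ?thesis
        using Cons.prems[of "d # zs" "e # zs"] d that by (simp add: cart_power_adj_Cons K4_adj_def)
    qed (use d in simp)
    then have "?A = UNIV - {z}"
      by blast
    then show ?thesis
      by (simp only: card_Diff_singleton finite UNIV_I card_bit0 card_num1) simp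
  qed
  moreover have "3 dvd card ?B"
  proof (rule Cons.IH)
    fix ws ws'
    assume "cart_power_adj K4_adj zs ws" "cart_power_adj K4_adj zs ws'" "cart_power_adj K4_adj ws
        ws'"
    then show "P (z # ws) = P (z # ws')"
      by (intro Cons.prems) (simp_all add: cart_power_adj_Cons)
  qed
  ultimately show ?case by simp
qed simp

lemma bc_coloring_c_1_three_dvd:
  assumes "has_bc_coloring_doob 0 n b 1"
  shows "3 dvd b"
proof -
  obtain f S where f: "perfect_coloring (doob_verts 0 n) doob_adj {1, 2 :: nat} S f" and S: "S 1 2
      = b" "S 2 1 = 1"
    using assms unfolding has_bc_coloring_doob_def perfect_bc_coloring_def by blast
  have im: "f ` doob_verts 0 n = {1, 2}"
    using f by (simp add: perfect_coloring_def)
  have "1 \<in> f ` doob_verts 0 n"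
    unfolding im by simp
  then obtain v where v: "1 = f v" "v \<in> doob_verts 0 n"
    by (rule imageE)
  obtain zs where zs: "v = ([], zs)" "length zs = n"
    using v(2) by (auto simp: doob_verts_hamming)
  have one: "card {w \<in> doob_verts 0 n. doob_adj u w \<and> f w = 1} = 1" if "u \<in> doob_verts 0 n" "f u =
      2" for u
    using perfect_coloring_card[OF f that(1) _, of 1] that(2) S(2) by simp
  have len: "length ws = n" if "cart_power_adj K4_adj zs ws" for ws
    using cart_power_adj_length[OF that] zs(2) by simp
  \<comment> \<open>On a line through the first-color vertex \<open>zs\<close>, another first-color
    vertex \<open>ws'\<close> would give \<open>ws\<close> two neighbours of the first color,
    against c = 1.\<close>
  have key: "f ([], ws') = 2" if adj: "cart_power_adj K4_adj zs ws" "cart_power_adj K4_adj zs ws'"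
    "cart_power_adj K4_adj ws ws'" and ws: "f ([], ws) = 2" for ws ws'
  proof (rule ccontr)
    assume "f ([], ws') \<noteq> 2"
    have mem: "([], ws) \<in> doob_verts 0 n" "([], ws') \<in> doob_verts 0 n"
      using len adj by (simp_all add: doob_verts_def)
    then have "f ([], ws') = 1"
      using im \<open>f ([], ws') \<noteq> 2\<close> by blast
    moreover have "cart_power_adj K4_adj ws zs"
      using adj(1) by (subst K4_power_adj_sym)
    ultimately have "{([], zs), ([], ws')} \<subseteq> {w \<in> doob_verts 0 n. doob_adj ([], ws) w \<and> f w = 1}"
      using v unfolding zs(1) by (simp only: insert_subset empty_subsetI mem_Collect_eq
          doob_adj_hamming mem adj(3) simp_thms)
    then have "card {([], zs) :: doob_vertex, ([], ws')} \<le> card {w \<in> doob_verts 0 n. doob_adj ([],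
        ws) w \<and> f w = 1}"
      by (intro card_mono) simp_all
    moreover have "zs \<noteq> ws'"
      using adj(2) cart_power_adj_irrefl[of K4_adj] by (auto simp: K4_adj_def)
    ultimately show False
      using one[OF mem(1) ws] by simp
  qed
  have "3 dvd card {ws. cart_power_adj K4_adj zs ws \<and> f ([], ws) = 2}"
  proof (rule three_dvd_card_K4_power_nbrs)
    fix ws ws'
    assume adj: "cart_power_adj K4_adj zs ws" "cart_power_adj K4_adj zs ws'" "cart_power_adj
        K4_adj ws ws'"
    have adj': "cart_power_adj K4_adj ws' ws"
      using adj(3) by (subst K4_power_adj_sym)
    show "(f ([], ws) = 2) = (f ([], ws') = 2)"
      using key[OF adj] key[OF adj(2,1) adj'] by (rule iffI)
  qed
  moreover have "{w \<in> doob_verts 0 n. doob_adj v w \<and> f w = 2} =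
      Pair [] ` {ws. cart_power_adj K4_adj zs ws \<and> f ([], ws) = 2}"
    unfolding zs(1) doob_verts_hamming using len by (simp only: Compr_image_eq doob_adj_hamming)
        blast
  moreover have "card {w \<in> doob_verts 0 n. doob_adj v w \<and> f w = 2} = b"
    using perfect_coloring_card[OF f v(2) _, of 2] v(1)[symmetric] S(1) by simp
  ultimately show ?thesis
    by (simp add: card_image inj_on_def)
qed

text \<open>An odd power of 2 is 2 modulo 3, which would make b equal to 1 modulo 3.\<close>

lemma power_2_three_dvd:
  assumes "b + 1 = (2 :: nat) ^ l" "3 dvd b"
  shows "\<exists>k. l = 2 * k"
proof (rule ccontr)
  assume "\<nexists>k. l = 2 * k"
  then have "odd l"
    by (auto elim: evenE)
  then obtain k where l: "l = 2 * k + 1"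
    by (rule oddE)
  have "(4 :: nat) ^ k mod 3 = 1"
    by (subst power_mod[symmetric]) simp
  then have "(b + 1) mod 3 = 2"
    unfolding assms(1) l by (simp add: power_add power_mult mod_mult_right_eq[symmetric,
        of 2 "4 ^ k"])
  moreover obtain i where "b = 3 * i"
    using assms(2) by blast
  ultimately show False
    by simp
qed

lemma infty_admissible_c_1:
  assumes "infty_admissible b 1" "0 < b"
  shows "\<exists>l > 0. b = 4 ^ l - 1"
proof -
  obtain N where "has_bc_coloring_doob 0 N b 1"
    using assms(1) unfolding infty_admissible_def by blast
  then have "3 dvd b"
    by (rule bc_coloring_c_1_three_dvd)
  moreover obtain l where l: "b + 1 = 2 ^ l"
    using infty_admissible_power_2[OF assms] by auto
  ultimately obtain k where "l = 2 * k"
    using power_2_three_dvd by blast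
  then have b: "b + 1 = 4 ^ k"
    using l by (simp add: power_mult)
  then have "k > 0" "b = 4 ^ k - 1"
    using assms(2) by (cases k; simp)+
  then show ?thesis by blast
qed

lemma admissible_0_gcd:
  assumes "0 < b" "0 < c" "2 \<le> gcd b c" "(b + c) div gcd b c = 2 ^ l" "b \<noteq> c \<or> even b"
  shows "admissible 0 b c"
proof -
  define g b' c' where "g = gcd b c" and "b' = b div g" and "c' = c div g"
  have g: "b = g * b'" "c = g * c'"
    by (simp_all add: g_def b'_def c'_def)
  have pos: "0 < b'" "0 < c'" "2 \<le> g"
    using assms(1,2,3) g unfolding g_def[symmetric] by (auto intro: gr0I)
  have "b + c = g * (b' + c')"
    by (simp only: distrib_left flip: g)
  then have "(b + c) div g = b' + c'"
    using pos(3) by simp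
  then have sum: "b' + c' = 2 ^ l"
    using assms(4) unfolding g_def[symmetric] by simp
  have l: "1 \<le> l"
    using pos sum by (cases l) auto
  have "(\<exists>k. kfold g (b' + c') (k * 1) (k * 0)) \<and> (\<exists>k. kfold g (b' + c') (k * 0) (k * 1))"
  proof (cases "2 \<le> l")
    case True
    then show ?thesis
      unfolding sum using shr.kfold_power[OF True pos(3)] ham.kfold_power[OF True pos(3)] by blast
  next
    \<comment> \<open>The reduced pair is (1,1), so b = c, and the parity assumption provides the
      even multiplicity.\<close>
    case False
    then have "l = 1" using l by simp
    then have "b' = 1" "c' = 1"
      using sum pos by auto
    then have "even g"
      using assms(5) g by simp
    then obtain i where i: "g = 2 * i" "1 \<le> i"
      using pos(3) by auto
    show ?thesis
      unfolding sum i(1) using shr.kfold_even[OF l i(2)] ham.kfold_even[OF l i(2)] by blast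
  qed
  then show ?thesis
    unfolding g using pos by (intro admissible_0) simp_all
qed

lemma admissible_8_coprime:
  assumes "0 < l" "b + c = 2 ^ (2 * l - 1)" "0 < b" "0 < c" "b \<noteq> 1" "c \<noteq> 1"
  shows "admissible 8 b c"
proof -
  \<comment> \<open>For l = 1 the sum would be 2, leaving only b = c = 1. The exponent therefore
    starts at 3 and the sum at 8.\<close>
  have "l \<noteq> 1"
    using assms by auto
  then have "l = (l - 2) + 2"
    using assms(1) by linarith
  then obtain i where "l = i + 2" ..
  then have "b + c = 8 * 4 ^ i"
    using assms(2) by (simp add: power_add power_mult)
  then show ?thesis
    using assms by (intro admissible_8) simp_all
qed

text \<open>The side conditions cut out pairs without colorings. The eigenvalues of
  \<open>D(m,n)\<close> differ from its degree by multiples of 4, and b + c is such a difference, so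
  4 divides b + c; this excludes b = c odd. If c = 1 then 3 divides b, which fails for b + 1 an odd
  power of two; exchanging the colors gives the same for b = 1.\<close>

theorem theorem8:
  fixes b c :: nat
  assumes "b > 0" and "c > 0"
  shows "(infty_admissible b 1 \<longleftrightarrow> (\<exists>l::nat. l > 0 \<and> b = 4 ^ l - 1))
    \<and> (b \<noteq> 1 \<and> c \<noteq> 1 \<and> (b \<noteq> c \<or> even b) \<longrightarrow>
        (infty_admissible b c \<longleftrightarrow> (\<exists>l::nat. (b + c) div gcd b c = 2 ^ l)))
    \<and> (admissible 1 b 1 \<longleftrightarrow> (\<exists>l::nat. l > 0 \<and> b = 4 ^ l - 1))
    \<and> (gcd b c \<ge> 2 \<and> (\<exists>l::nat. (b + c) div gcd b c = 2 ^ l) \<and> (b \<noteq> c \<or> even b) \<longrightarrow>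
        admissible 0 b c)
    \<and> (gcd b c = 1 \<and> (\<exists>l::nat. (b + c) div gcd b c = 4 ^ l) \<longrightarrow> admissible 1 b c)
    \<and> (gcd b c = 1 \<and> (\<exists>l::nat. l > 0 \<and> (b + c) div gcd b c = 2 ^ (2 * l - 1)) \<and>
        b \<noteq> 1 \<and> c \<noteq> 1 \<longrightarrow> admissible 8 b c)"
proof -
  have five: "admissible 1 b c" if "0 < c" "b + c = 4 ^ l" for c l
    using admissible_1[OF that(2) assms(1) that(1)] .
  have one: "admissible 1 b 1" if "b = 4 ^ l - 1" for l
    using that assms(1) by (intro five[of 1 l]) simp_all
  have 1: "infty_admissible b 1 \<longleftrightarrow> (\<exists>l::nat. l > 0 \<and> b = 4 ^ l - 1)"
    using infty_admissible_c_1[OF _ assms(1)] one admissible_imp_infty by blast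
  have 3: "admissible 1 b 1 \<longleftrightarrow> (\<exists>l::nat. l > 0 \<and> b = 4 ^ l - 1)"
    using 1 one admissible_imp_infty by blast
  have 4: "admissible 0 b c" if "gcd b c \<ge> 2" "(b + c) div gcd b c = 2 ^ l" "b \<noteq> c \<or> even b" for l
    using admissible_0_gcd[OF assms that] .
  have 5: "admissible 1 b c" if "gcd b c = 1" "(b + c) div gcd b c = 4 ^ l" for l
    using that five[OF assms(2), of l] by simp
  have 6: "admissible 8 b c" if "gcd b c = 1" "l > 0" "(b + c) div gcd b c =
      2 ^ (2 * l - 1)" "b \<noteq> 1" "c \<noteq> 1" for l
    using that admissible_8_coprime[of l b c] assms by simp
  have 2: "infty_admissible b c" if l: "(b + c) div gcd b c =
      2 ^ l" and bc: "b \<noteq> 1" "c \<noteq> 1" "b \<noteq> c \<or> even b" for l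
  proof (cases "gcd b c = 1")
    case False
    then have "gcd b c \<ge> 2"
      using assms gcd_pos_nat[of b c] by linarith
    then show ?thesis
      using 4[OF _ l bc(3)] admissible_imp_infty by blast
  next
    case True
    show ?thesis
    \<comment> \<open>For coprime pairs the parity of the exponent decides between the 1-fold covers
      and the families of colorings.\<close>
    proof (cases "even l")
      case True
      then obtain k where "l = 2 * k" by blast
      then have "(b + c) div gcd b c = 4 ^ k"
        using l by (simp add: power_mult)
      then show ?thesis
        using 5[OF \<open>gcd b c = 1\<close>] admissible_imp_infty by blast
    next
      case False
      then obtain k where "l = 2 * k + 1"
        by (rule oddE)
      then have "(b + c) div gcd b c = 2 ^ (2 * (k + 1) - 1)"
        using l by simp
      then show ?thesis
        using 6[OF \<open>gcd b c = 1\<close> _ _ bc(1,2)] admissible_imp_infty by (metis add_gr_0 zero_less_one)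
    qed
  qed
  have 2: "b \<noteq> 1 \<and> c \<noteq> 1 \<and> (b \<noteq> c \<or> even b) \<longrightarrow>
      (infty_admissible b c \<longleftrightarrow> (\<exists>l::nat. (b + c) div gcd b c = 2 ^ l))"
    using 2 infty_admissible_power_2[OF _ assms] by blast
  have 4: "gcd b c \<ge> 2 \<and> (\<exists>l::nat. (b + c) div gcd b c = 2 ^ l) \<and> (b \<noteq> c \<or> even b) \<longrightarrow>
      admissible 0 b c"
    by (intro impI, elim conjE exE) (rule 4)
  have 5: "gcd b c = 1 \<and> (\<exists>l::nat. (b + c) div gcd b c = 4 ^ l) \<longrightarrow> admissible 1 b c"
    by (intro impI, elim conjE exE) (rule 5)
  have 6: "gcd b c = 1 \<and> (\<exists>l::nat. l > 0 \<and> (b + c) div gcd b c = 2 ^ (2 * l - 1)) \<and>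
      b \<noteq> 1 \<and> c \<noteq> 1 \<longrightarrow> admissible 8 b c"
    by (intro impI, elim conjE exE) (rule 6)
  show ?thesis
    by (intro conjI 1 2 3 4 5 6)
qed

end
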